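(* Let $x_0<x_1$ and let $f:[x_0,x_1]\to\mathbb R$ be a concave continuous non-negative function. Put $A_2=(x_0,f(x_0))$ and $A_1=(x_1,f(x_1))$. Let $P_2x+Q_2y+c_{P_2,Q_2}=0$ be a line tangent to the graph of $f$ at $A_2$, and let $P_1x+Q_1y+c_{P_1,Q_1}=0$ be a line tangent to the graph of $f$ at $A_1$, where $P_i,Q_i\in\mathbb R$, $P_1Q_2-P_2Q_1=D>0$, and $P_ix+Q_if(x)+c_{P_i,Q_i}\le 0$ for $i=1,2$ and all $x\in[x_0,x_1]$. Let $A_{12}$ be the intersection point of these two lines. Let $S$ be the area of the region enclosed between these two lines and the graph of $f$ (i.e. bounded by the segments $A_2A_{12}$, $A_{12}A_1$ and the graph). Let $L$ be the sum of the lattice lengths of the segments $A_1A_{12}$ and $A_2A_{12}$ minus the lattice length of the curve $\{(x,f(x)): x_0\le x\le x_1\}$, all lattice lengths being taken with respect to the lattice $\Lambda=\mathbb Z(P_1,Q_1)+\mathbb Z(P_2,Q_2)$. Then $$\frac{1}{2D}\sum (c_{p_1,q_1}+c_{p_2,q_2}-c_{p_1+p_2,q_1+q_2})^2=S,$$ $$\frac{1}{D}\sum (c_{p_1+p_2,q_1+q_2}-c_{p_1,q_1}-c_{p_2,q_2})=L,$$ where both sums run over all matrices $$\begin{pmatrix} p_1 & q_1 \\ p_2 & q_2 \end{pmatrix}\in SL^{+}(2,\mathbb Z)\cdot\begin{pmatrix} P_1 & Q_1 \\ P_2 & Q_2 \end{pmatrix},$$ and $c_{p,q}$ is chosen so that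 $px+qy+c_{p,q}=0$ is a tangent line to the graph of $f$ (with $px+qf(x)+c_{p,q}\le 0$ on $[x_0,x_1]$).
   Context: $SL^{+}(2,\mathbb Z)$ is the submonoid (containing the identity) of $SL(2,\mathbb Z)$ generated by $\begin{pmatrix} 1 & 1 \\ 0 & 1 \end{pmatrix}$ and $\begin{pmatrix} 1 & 0 \\ 1 & 1 \end{pmatrix}$. "Tangent line" to the graph is understood as a supporting line: a line meeting the graph and having the graph on one (closed) side; thus $c_{p,q}=-\max_{x\in[x_0,x_1]}(px+qf(x))$. Lattice length with respect to $\Lambda$: if a segment $I$ lies on a line $px+qy+c=0$ with $(p,q)$ a primitive vector of $\Lambda$, its lattice length is its Euclidean length divided by $\sqrt{p^2+q^2}$. (For $\Lambda=\mathbb Z^2$ this is the Euclidean length divided by the length of the primitive integer vector in the direction of $I$.) The lattice length of a curve is the sum of the lattice lengths of its maximal straight-line parts that have a normal vector in $\Lambda$; if there are no such parts, the lattice length is zero. *)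

theory Defs
  imports "HOL-Analysis.Analysis"
begin

inductive_set SL2Z_plus :: "(int^2^2) set" where
  one: "mat 1 \<in> SL2Z_plus"
| upper: "vector [vector [1, 1], vector [0, 1]] \<in> SL2Z_plus"
| lower: "vector [vector [1, 0], vector [1, 1]] \<in> SL2Z_plus"
| mult: "A \<in> SL2Z_plus \<Longrightarrow> B \<in> SL2Z_plus \<Longrightarrow> A ** B \<in> SL2Z_plus"

definition SL2Z_plus_orbit :: "real^2^2 \<Rightarrow> (real^2^2) set" where
  "SL2Z_plus_orbit M = (\<lambda>A. map_matrix real_of_int A ** M) ` SL2Z_plus"

definition curve_graph :: "real \<Rightarrow> real \<Rightarrow> (real \<Rightarrow> real) \<Rightarrow> (real^2) set" where
  "curve_graph a b f = (\<lambda>x. vector [x, f x]) ` {a..b}"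

text \<open>For \<open>v = (p, q)\<close> this is the line \<open>p x + q y + k = 0\<close>.\<close>

definition line :: "real^2 \<Rightarrow> real \<Rightarrow> (real^2) set" where
  "line v k = {z. v \<bullet> z + k = 0}"

text \<open>Tangency means supporting: the line meets the curve, and the curve lies in the
  half-plane \<open>p x + q y + k \<le> 0\<close>. The sign of \<open>v\<close> therefore matters.\<close>

definition tangent_at :: "(real^2) set \<Rightarrow> real^2 \<Rightarrow> real \<Rightarrow> real^2 \<Rightarrow> bool" where
  "tangent_at C v k A \<longleftrightarrow>
     v \<noteq> 0 \<and> A \<in> C \<and> A \<in> line v k \<and> (\<forall>z\<in>C. v \<bullet> z + k \<le> 0)"

definition tangent :: "(real^2) set \<Rightarrow> real^2 \<Rightarrow> real \<Rightarrow> bool" where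
  "tangent C v k \<longleftrightarrow> (\<exists>A. tangent_at C v k A)"

lemma tangent_iff_Sup:
  assumes "compact C" "C \<noteq> {}"
  shows "tangent C v k \<longleftrightarrow> v \<noteq> 0 \<and> k = - (SUP z\<in>C. v \<bullet> z)"
proof -
  have "continuous_on C (\<lambda>z. v \<bullet> z)"
    by (intro continuous_intros)
  then obtain A where A: "A \<in> C" "\<And>z. z \<in> C \<Longrightarrow> v \<bullet> z \<le> v \<bullet> A"
    using continuous_attains_sup[OF assms] by blast
  have sup: "(SUP z\<in>C. v \<bullet> z) = v \<bullet> A"
    using A by (intro cSup_eq_maximum) auto
  have "tangent C v k \<longleftrightarrow> v \<noteq> 0 \<and> k = - (v \<bullet> A)"
  proof
    assume "tangent C v k"
    then obtain B where B: "v \<noteq> 0" "B \<in> C" "v \<bullet> B + k = 0" "\<forall>z\<in>C. v \<bullet> z + k \<le> 0"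
      by (auto simp: tangent_def tangent_at_def line_def)
    with A show "v \<noteq> 0 \<and> k = - (v \<bullet> A)"
      by (smt (verit, best))
  next
    assume "v \<noteq> 0 \<and> k = - (v \<bullet> A)"
    with A show "tangent C v k"
      by (auto simp: tangent_def tangent_at_def line_def intro!: exI[of _ A])
  qed
  with sup show ?thesis
    by simp
qed

definition lattice_of :: "real^2 \<Rightarrow> real^2 \<Rightarrow> (real^2) set" where
  "lattice_of v w = {of_int m *\<^sub>R v + of_int n *\<^sub>R w | m n. True}"

definition primitive_in :: "(real^2) set \<Rightarrow> real^2 \<Rightarrow> bool" where
  "primitive_in \<Lambda> v \<longleftrightarrow>
     v \<in> \<Lambda> \<and> v \<noteq> 0 \<and> \<not> (\<exists>w\<in>\<Lambda>. \<exists>k::nat. k \<ge> 2 \<and> v = real k *\<^sub>R w)"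

text \<open>A segment is represented as a set of points, its Euclidean length being its diameter.
  Primitive normal vectors of a nondegenerate segment agree up to sign, and a segment reduced
  to a point has diameter 0, so the value does not depend on the choice of \<open>v\<close>. It is only
  meaningful for segments with a normal vector in \<open>\<Lambda>\<close>.\<close>

definition lattice_length :: "(real^2) set \<Rightarrow> (real^2) set \<Rightarrow> real" where
  "lattice_length \<Lambda> I =
     (THE l. \<exists>v k. primitive_in \<Lambda> v \<and> I \<subseteq> line v k \<and> l = diameter I / norm v)"

definition straight_parts :: "(real^2) set \<Rightarrow> (real^2) set set" where
  "straight_parts C = {closed_segment A B | A B. A \<noteq> B \<and> closed_segment A B \<subseteq> C}"

definition maximal_straight_parts :: "(real^2) set \<Rightarrow> (real^2) set set" where
  "maximal_straight_parts C =
     {I \<in> straight_parts C. \<forall>J\<in>straight_parts C. I \<subseteq> J \<longrightarrow> J = I}"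

text \<open>There may be infinitely many maximal straight parts.\<close>

definition lattice_length_curve :: "(real^2) set \<Rightarrow> (real^2) set \<Rightarrow> real" where
  "lattice_length_curve \<Lambda> C =
     (\<Sum>\<^sub>\<infinity>I | I \<in> maximal_straight_parts C \<and> (\<exists>v\<in>\<Lambda>. v \<noteq> 0 \<and> (\<exists>k. I \<subseteq> line v k)).
        lattice_length \<Lambda> I)"

end

theory Submission
  imports Defs
begin

text \<open>
  Let \<open>h\<close> be the support function of the graph \<open>\<Gamma>\<close>, so that \<open>c v = - h v\<close>. The supporting lines
  with normals \<open>u\<close> and \<open>v\<close> meet in a corner, and the supporting line with the mediant normal
  \<open>u + v\<close> cuts a triangle off this corner. In the linear coordinates \<open>h u - u \<bullet> z\<close> and
  \<open>h v - v \<bullet> z\<close> this triangle is \<open>X, Y \<ge> 0, X + Y \<le> \<delta>\<close> with the gap \<open>\<delta> = h u + h v - h (u + v)\<close>.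
  Hence its area is \<open>\<delta>\<^sup>2 / (2 * D)\<close>, and each of its three sides has lattice length \<open>\<delta> / D\<close>, where
  \<open>D\<close> is the determinant of the pair. Passing from \<open>(u, v)\<close> to \<open>(u, u + v)\<close> and to \<open>(u + v, v)\<close>
  keeps \<open>D\<close> and generates the whole orbit, each matrix exactly once. It is therefore indexed by words
  over two letters (\<open>has_sum_orbit_iff\<close>).

  Area: the triangles of all words are disjoint and tile the part of the corner that lies
  beyond some supporting line with a normal in the cone of \<open>v1\<close> and \<open>v2\<close>. A point beyond a
  supporting line determines an open convex set of normals, and the Stern-Brocot tree contains exactly
  one node at which such a set is hit for the first time (\<open>gap_square_has_sum\<close>). Up to the two lines
  this part of the corner is the inside of the closed curve made of the two segments and the graph
  (\<open>inside_contour\<close>).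

  Length: the cut at \<open>(u, v)\<close> creates an edge with normal \<open>m = u + v\<close> and with length equal to the gap
  (in units of \<open>1 / D\<close>). The later cuts that shorten this edge are those at the pairs
  \<open>(u + k m, m)\<close> and \<open>(m, v + k m)\<close>; their gaps telescope, and what remains is the length of the face of
  \<open>\<Gamma>\<close> with normal \<open>m\<close>. Every pair occurs once as a creator and, apart from two exceptional rows,
  once as a shortener at either end. Summing over the tree expresses the sum of the gaps by the
  two legs and the lengths of all faces (\<open>gap_sum\<close>). The faces that have a normal in \<open>\<Lambda>\<close> and in the
  cone, and that are not single points, are exactly the maximal straight parts counted by the
  lattice length of the curve (\<open>lattice_straight_parts_eq\<close>).

  The geometry of the curve enters only through the locale \<open>convex_arc\<close>, which graphs
  of concave functions satisfy.
\<close>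

section \<open>Words and the Stern-Brocot tree\<close>

text \<open>A pair \<open>(u, v)\<close> stands for the cone that it spans, and its mediant \<open>u + v\<close> splits the cone in two.
  The first letter of a word selects the half that contains \<open>u\<close> (\<open>True\<close>) or \<open>v\<close> (\<open>False\<close>).\<close>

fun farey :: "bool list \<Rightarrow> 'v::ab_semigroup_add \<times> 'v \<Rightarrow> 'v \<times> 'v" where
  "farey [] p = p"
| "farey (True # w) (u, v) = farey w (u, u + v)"
| "farey (False # w) (u, v) = farey w (u + v, v)"

definition mediant :: "'v::ab_semigroup_add \<times> 'v \<Rightarrow> 'v" where
  "mediant p = fst p + snd p"

text \<open>The coordinates of the mediant reached by a word, with respect to the pair at the root.\<close>

fun node :: "bool list \<Rightarrow> nat \<times> nat" where
  "node [] = (1, 1)"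
| "node (True # w) = (fst (node w) + snd (node w), snd (node w))"
| "node (False # w) = (fst (node w), fst (node w) + snd (node w))"

lemma farey_append: "farey (w @ w') p = farey w' (farey w p)"
  by (induction w p rule: farey.induct) auto

lemma farey_replicate:
  fixes u v :: "'v::real_vector"
  shows "farey (replicate k True) (u, v) = (u, v + real k *\<^sub>R u)"
    and "farey (replicate k False) (u, v) = (u + real k *\<^sub>R v, v)"
  by (induction k arbitrary: u v) (auto simp: algebra_simps)

lemma mediant_farey:
  fixes u v :: "'v::real_vector"
  shows "mediant (farey w (u, v)) = real (fst (node w)) *\<^sub>R u + real (snd (node w)) *\<^sub>R v"
  by (induction w arbitrary: u v rule: node.induct) (auto simp: algebra_simps mediant_def)

lemma node_pos: "0 < fst (node w)" "0 < snd (node w)"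
  by (induction w rule: node.induct) auto

lemma coprime_node: "coprime (fst (node w)) (snd (node w))"
  by (induction w rule: node.induct) (auto simp: coprime_iff_gcd_eq_1)

text \<open>The tree is free: \<open>(a, b)\<close> is the root exactly if \<open>a = b\<close>, and otherwise the first letter is
  recovered from the comparison of \<open>a\<close> and \<open>b\<close>.\<close>

lemma node_eqD:
  "node w = node w' \<Longrightarrow> w = w'"
proof (induction w arbitrary: w' rule: node.induct)
  case 1
  show ?case
  proof (cases w' rule: node.cases)
    case (2 w'')
    then show ?thesis using 1 node_pos[of w''] by simp
  next
    case (3 w'')
    then show ?thesis using 1 node_pos[of w''] by simp
  qed simp
next
  case (2 w)
  show ?case
  proof (cases w' rule: node.cases)
    case 1
    then show ?thesis using "2.prems" node_pos[of w] by simp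
  next
    case (2 w'')
    then show ?thesis using "2.IH"[of w''] "2.prems" by (simp add: prod_eq_iff)
  next
    case (3 w'')
    then show ?thesis using "2.prems" node_pos[of w] node_pos[of w''] by simp
  qed
next
  case (3 w)
  show ?case
  proof (cases w' rule: node.cases)
    case 1
    then show ?thesis using "3.prems" node_pos[of w] by simp
  next
    case (2 w'')
    then show ?thesis using "3.prems" node_pos[of w] node_pos[of w''] by simp
  next
    case (3 w'')
    then show ?thesis using "3.IH"[of w''] "3.prems" by (simp add: prod_eq_iff)
  qed
qed

lemma inj_node: "inj node"
  by (rule injI) (rule node_eqD)

text \<open>The subtractive Euclidean algorithm is the inverse of \<open>node\<close>.\<close>

lemma node_surj:
  assumes "coprime a b" "0 < a" "0 < b"
  shows "\<exists>w. node w = (a, b)"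
  using assms
proof (induction "a + b" arbitrary: a b rule: less_induct)
  case less
  consider "a = b" | "a < b" | "b < a"
    by linarith
  then show ?case
  proof cases
    case 1
    with less.prems have "node [] = (a, b)"
      by simp
    then show ?thesis ..
  next
    case 2
    have "coprime a (b - a)"
      using less.prems 2 by (metis coprime_iff_gcd_eq_1 gcd_diff1_nat gcd.commute less_imp_le)
    with less.hyps[of a "b - a"] less.prems 2 obtain w where "node w = (a, b - a)"
      by auto
    with 2 have "node (False # w) = (a, b)"
      by simp
    then show ?thesis ..
  next
    case 3
    have "coprime (a - b) b"
      using less.prems 3 by (metis coprime_iff_gcd_eq_1 gcd_diff1_nat less_imp_le)
    with less.hyps[of "a - b" b] less.prems 3 obtain w where "node w = (a - b, b)"
      by auto
    with 3 have "node (True # w) = (a, b)"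
      by simp
    then show ?thesis ..
  qed
qed

definition det2 :: "real^2 \<Rightarrow> real^2 \<Rightarrow> real" where
  "det2 u v = u$1 * v$2 - u$2 * v$1"

lemma det2_simps:
  "det2 (u + v) w = det2 u w + det2 v w" "det2 w (u + v) = det2 w u + det2 w v"
  "det2 (u - v) w = det2 u w - det2 v w" "det2 w (u - v) = det2 w u - det2 w v"
  "det2 (r *\<^sub>R u) v = r * det2 u v" "det2 u (r *\<^sub>R v) = r * det2 u v"
  "det2 u u = 0" "det2 (- u) v = - det2 u v" "det2 u (- v) = - det2 u v"
  by (auto simp: det2_def algebra_simps)

lemma det2_nonzero:
  assumes "det2 u v \<noteq> 0"
  shows "u \<noteq> 0" "v \<noteq> 0" "u + v \<noteq> 0"
proof -
  show "u \<noteq> 0" "v \<noteq> 0"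
    using assms by (auto simp: det2_def)
  show "u + v \<noteq> 0"
  proof
    assume "u + v = 0"
    then have "det2 u (u + v) = 0"
      by (simp add: det2_def)
    with assms show False
      by (simp add: det2_simps)
  qed
qed

lemma det2_farey: "det2 (fst (farey w p)) (snd (farey w p)) = det2 (fst p) (snd p)"
  by (induction w p rule: farey.induct) (auto simp: det2_simps)

lemma det2_independent:
  assumes "det2 u v \<noteq> 0" "a *\<^sub>R u + b *\<^sub>R v = a' *\<^sub>R u + b' *\<^sub>R v"
  shows "a = a' \<and> b = b'"
proof -
  have "det2 (a *\<^sub>R u + b *\<^sub>R v) v = det2 (a' *\<^sub>R u + b' *\<^sub>R v) v"
       "det2 u (a *\<^sub>R u + b *\<^sub>R v) = det2 u (a' *\<^sub>R u + b' *\<^sub>R v)"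
    using assms(2) by simp_all
  with assms(1) show ?thesis
    by (auto simp: det2_simps)
qed

text \<open>The letters are multiplied from right to left, since the first letter is the first to act on
  the rows.\<close>

fun word_matrix :: "bool list \<Rightarrow> int^2^2" where
  "word_matrix [] = mat 1"
| "word_matrix (True # w) = word_matrix w ** vector [vector [1, 0], vector [1, 1]]"
| "word_matrix (False # w) = word_matrix w ** vector [vector [1, 1], vector [0, 1]]"

lemma word_matrix_append: "word_matrix (w @ w') = word_matrix w' ** word_matrix w"
proof (induction w rule: word_matrix.induct)
  case 1
  show ?case by simp
next
  case (2 w)
  then show ?case by (simp only: append.simps word_matrix.simps matrix_mul_assoc)
next
  case (3 w)
  then show ?case by (simp only: append.simps word_matrix.simps matrix_mul_assoc)
qed

lemma SL2Z_plus_eq_words: "SL2Z_plus = range word_matrix"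
proof (intro subset_antisym subsetI)
  fix A assume "A \<in> SL2Z_plus"
  then show "A \<in> range word_matrix"
  proof induction
    case one
    then show ?case by (metis word_matrix.simps(1) rangeI)
  next
    case upper
    have "word_matrix [False] = vector [vector [1, 1], vector [0, 1]]" by simp
    then show ?case by (metis rangeI)
  next
    case lower
    have "word_matrix [True] = vector [vector [1, 0], vector [1, 1]]" by simp
    then show ?case by (metis rangeI)
  next
    case (mult A B)
    then obtain w w' where "A = word_matrix w" "B = word_matrix w'"
      by auto
    then have "A ** B = word_matrix (w' @ w)"
      by (simp add: word_matrix_append)
    then show ?case by simp
  qed
next
  fix A assume "A \<in> range word_matrix"
  then obtain w where "A = word_matrix w" by auto
  then show "A \<in> SL2Z_plus"
    by (induction w arbitrary: A rule: word_matrix.induct) (auto intro: SL2Z_plus.intros)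
qed

definition rows :: "'a^2^2 \<Rightarrow> ('a^2) \<times> ('a^2)" where
  "rows M = (M $ 1, M $ 2)"

lemma rows_eq_iff: "rows M = rows N \<longleftrightarrow> M = N"
  by (auto simp: rows_def vec_eq_iff forall_2)

lemma map_matrix_of_int_mult:
  "map_matrix real_of_int (A ** B) = map_matrix real_of_int A ** map_matrix real_of_int B"
  by (simp add: vec_eq_iff matrix_matrix_mult_def)

lemma rows_word_matrix:
  "rows (map_matrix real_of_int (word_matrix w) ** M) = farey w (rows M)"
proof (induction w arbitrary: M rule: word_matrix.induct)
  case 1
  have "map_matrix real_of_int (mat 1 :: int^2^2) = mat 1"
    by (simp add: vec_eq_iff mat_def)
  then show ?case by simp
next
  case (2 w)
  have "rows (map_matrix real_of_int (vector [vector [1, 0], vector [1, 1]]) ** M)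
        = (M $ 1, M $ 1 + M $ 2)"
    by (simp add: rows_def vec_eq_iff matrix_matrix_mult_def sum_2 forall_2)
  with 2 show ?case
    by (simp add: map_matrix_of_int_mult matrix_mul_assoc[symmetric]) (simp add: rows_def)
next
  case (3 w)
  have "rows (map_matrix real_of_int (vector [vector [1, 1], vector [0, 1]]) ** M)
        = (M $ 1 + M $ 2, M $ 2)"
    by (simp add: rows_def vec_eq_iff matrix_matrix_mult_def sum_2 forall_2)
  with 3 show ?case
    by (simp add: map_matrix_of_int_mult matrix_mul_assoc[symmetric]) (simp add: rows_def)
qed

lemma inj_farey:
  assumes "det2 u v \<noteq> 0"
  shows "inj (\<lambda>w. farey w (u, v))"
proof
  fix w w' assume "farey w (u, v) = farey w' (u, v)"
  then have "mediant (farey w (u, v)) = mediant (farey w' (u, v))"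
    by simp
  then have "node w = node w'"
    using det2_independent[OF assms, of "real (fst (node w))" "real (snd (node w))"
        "real (fst (node w'))" "real (snd (node w'))"]
    by (simp add: mediant_farey prod_eq_iff)
  then show "w = w'"
    using inj_node by (auto dest: injD)
qed

text \<open>The orbit is parametrised by the tree; for linearly independent rows \<open>inj_farey\<close> says that no
  matrix is counted twice.\<close>

lemma bij_betw_orbit:
  assumes "det2 v1 v2 \<noteq> 0"
  shows "bij_betw rows (SL2Z_plus_orbit (vector [v1, v2])) (range (\<lambda>w. farey w (v1, v2)))"
proof -
  have "rows ` SL2Z_plus_orbit (vector [v1, v2]) = range (\<lambda>w. farey w (v1, v2))"
    unfolding SL2Z_plus_orbit_def SL2Z_plus_eq_words image_image
    by (simp add: rows_word_matrix) (simp add: rows_def)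
  moreover have "inj_on rows (SL2Z_plus_orbit (vector [v1, v2]))"
    by (auto simp: inj_on_def rows_eq_iff)
  ultimately show ?thesis
    by (simp add: bij_betw_def)
qed

lemma has_sum_orbit_iff:
  fixes G :: "(real^2) \<times> (real^2) \<Rightarrow> real"
  assumes "det2 v1 v2 \<noteq> 0"
  shows "((\<lambda>M. G (rows M)) has_sum s) (SL2Z_plus_orbit (vector [v1, v2]))
     \<longleftrightarrow> ((\<lambda>w. G (farey w (v1, v2))) has_sum s) UNIV"
proof -
  have "((\<lambda>M. G (rows M)) has_sum s) (SL2Z_plus_orbit (vector [v1, v2]))
     \<longleftrightarrow> (G has_sum s) (range (\<lambda>w. farey w (v1, v2)))"
    by (rule has_sum_reindex_bij_betw[OF bij_betw_orbit[OF assms]])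
  also have "\<dots> \<longleftrightarrow> ((\<lambda>w. G (farey w (v1, v2))) has_sum s) UNIV"
    using has_sum_reindex[OF inj_farey[OF assms], of G s] by (simp add: o_def)
  finally show ?thesis .
qed

text \<open>A word is either a power of the letter \<open>b\<close> or is cut in a unique way at its last letter
  different from \<open>b\<close>.\<close>

lemma words_split:
  shows "range (\<lambda>k. replicate k b) \<union> (\<lambda>(w, k). w @ (\<not> b) # replicate k b) ` UNIV = UNIV"
    and "range (\<lambda>k. replicate k b) \<inter> (\<lambda>(w, k). w @ (\<not> b) # replicate k b) ` UNIV = {}"
    and "inj (\<lambda>(w, k). w @ (\<not> b) # replicate k b)"
    and "inj (\<lambda>k. replicate k b)"
proof -
  have "w \<in> range (\<lambda>k. replicate k b) \<union> (\<lambda>(w, k). w @ (\<not> b) # replicate k b) ` UNIV" for w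
  proof (induction w)
    case Nil
    have "[] = replicate 0 b" by simp
    then show ?case by blast
  next
    case (Cons x w)
    from Cons.IH show ?case
    proof
      assume "w \<in> range (\<lambda>k. replicate k b)"
      then obtain k where k: "w = replicate k b" by auto
      show ?thesis
      proof (cases "x = b")
        case True
        with k have "x # w = replicate (Suc k) b" by simp
        then show ?thesis by blast
      next
        case False
        with k have "x # w = (\<lambda>(w, k). w @ (\<not> b) # replicate k b) ([], k)" by auto
        then show ?thesis by blast
      qed
    next
      assume "w \<in> (\<lambda>(w, k). w @ (\<not> b) # replicate k b) ` UNIV"
      then obtain w' k where "w = w' @ (\<not> b) # replicate k b" by auto
      then have "x # w = (\<lambda>(w, k). w @ (\<not> b) # replicate k b) (x # w', k)" by auto
      then show ?thesis by blast
    qed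
  qed
  then show "range (\<lambda>k. replicate k b) \<union> (\<lambda>(w, k). w @ (\<not> b) # replicate k b) ` UNIV = UNIV"
    by blast
  have "replicate k b \<noteq> w @ (\<not> b) # replicate k' b" for k k' w
  proof
    assume "replicate k b = w @ (\<not> b) # replicate k' b"
    then have "(\<not> b) \<in> set (replicate k b)" by simp
    then show False by simp
  qed
  then show "range (\<lambda>k. replicate k b) \<inter> (\<lambda>(w, k). w @ (\<not> b) # replicate k b) ` UNIV = {}"
    by auto
  \<comment> \<open>The exponent is recovered as the length of the final run of the letter \<open>b\<close>.\<close>
  have len: "length (takeWhile (\<lambda>x. x = b) (rev (w @ (\<not> b) # replicate k b))) = k" for w k
    by (simp add: takeWhile_append takeWhile_replicate)
  show "inj (\<lambda>(w, k). w @ (\<not> b) # replicate k b)"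
  proof (rule injI, clarsimp)
    fix w k w' k' assume *: "w @ (\<not> b) # replicate k b = w' @ (\<not> b) # replicate k' b"
    then have "k = k'" using len[of w k] len[of w' k'] by metis
    with * show "w = w' \<and> k = k'" by simp
  qed
  show "inj (\<lambda>k. replicate k b)"
    by (rule injI) (metis length_replicate)
qed

text \<open>The inner sum runs over the descendants \<open>w @ (\<not> b) # replicate k b\<close> of \<open>w\<close>. In the tree
  these are the pairs that have the mediant of \<open>w\<close> as one member, always on the same side. Each of
  the two families of rows thus exhausts the tree except for one boundary row.\<close>

lemma summable_word_split:
  fixes g :: "bool list \<Rightarrow> real"
  assumes "g summable_on UNIV"
  shows "(\<lambda>w. \<Sum>\<^sub>\<infinity>k. g (w @ (\<not> b) # replicate k b)) summable_on UNIV"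
    and "(\<Sum>\<^sub>\<infinity>w. g w) = (\<Sum>\<^sub>\<infinity>k. g (replicate k b))
           + (\<Sum>\<^sub>\<infinity>w. \<Sum>\<^sub>\<infinity>k. g (w @ (\<not> b) # replicate k b))"
proof -
  let ?j = "\<lambda>(w, k). w @ (\<not> b) # replicate k b"
  have sub: "g summable_on X" for X
    using assms summable_on_subset_banach by blast
  have 1: "(g \<circ> ?j) summable_on UNIV"
    using sub[of "?j ` UNIV"] summable_on_reindex[OF words_split(3)] by blast
  then have 2: "(\<lambda>(w, k). g (w @ (\<not> b) # replicate k b)) summable_on UNIV \<times> UNIV"
    by (simp add: o_def case_prod_unfold)
  from summable_on_Sigma_banach[OF this]
  show "(\<lambda>w. \<Sum>\<^sub>\<infinity>k. g (w @ (\<not> b) # replicate k b)) summable_on UNIV" .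
  have "(\<Sum>\<^sub>\<infinity>w. g w) = infsum g (range (\<lambda>k. replicate k b)) + infsum g (?j ` UNIV)"
    using infsum_Un_disjoint[OF sub sub words_split(2)[of b]] by (simp only: words_split(1))
  also have "infsum g (range (\<lambda>k. replicate k b)) = (\<Sum>\<^sub>\<infinity>k. g (replicate k b))"
    by (subst infsum_reindex[OF words_split(4)]) (simp add: o_def)
  also have "infsum g (?j ` UNIV) = infsum (g \<circ> ?j) (UNIV \<times> UNIV)"
    by (subst infsum_reindex[OF words_split(3)]) simp
  also have "\<dots> = (\<Sum>\<^sub>\<infinity>w. \<Sum>\<^sub>\<infinity>k. g (w @ (\<not> b) # replicate k b))"
    using infsum_Sigma'_banach[OF 2] by (simp add: o_def case_prod_unfold)
  finally show "(\<Sum>\<^sub>\<infinity>w. g w) = (\<Sum>\<^sub>\<infinity>k. g (replicate k b))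
           + (\<Sum>\<^sub>\<infinity>w. \<Sum>\<^sub>\<infinity>k. g (w @ (\<not> b) # replicate k b))" .
qed

section \<open>Support functions and the sum of the gaps\<close>

definition supp :: "'a::real_inner set \<Rightarrow> 'a \<Rightarrow> real" where
  "supp S u = (SUP z\<in>S. u \<bullet> z)"

definition face :: "'a::real_inner set \<Rightarrow> 'a \<Rightarrow> 'a set" where
  "face S u = {z\<in>S. u \<bullet> z = supp S u}"

lemma supp_attained:
  assumes "compact S" "S \<noteq> {}"
  obtains z where "z \<in> S" "u \<bullet> z = supp S u"
proof -
  have "continuous_on S (\<lambda>z. u \<bullet> z)"
    by (intro continuous_intros)
  then obtain z where z: "z \<in> S" "\<And>y. y \<in> S \<Longrightarrow> u \<bullet> y \<le> u \<bullet> z"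
    using continuous_attains_sup[OF assms] by blast
  then have "supp S u = u \<bullet> z"
    unfolding supp_def by (intro cSup_eq_maximum) auto
  with z show ?thesis
    using that by auto
qed

lemma supp_eqI:
  assumes "z \<in> S" "\<And>y. y \<in> S \<Longrightarrow> u \<bullet> y \<le> u \<bullet> z"
  shows "supp S u = u \<bullet> z"
  unfolding supp_def using assms by (intro cSup_eq_maximum) auto

context
  fixes S :: "'a::real_inner set"
  assumes S: "compact S" "S \<noteq> {}"
begin

lemma supp_upper: "z \<in> S \<Longrightarrow> u \<bullet> z \<le> supp S u"
proof -
  assume "z \<in> S"
  moreover have "bdd_above ((\<lambda>z. u \<bullet> z) ` S)"
    by (intro bounded_imp_bdd_above compact_imp_bounded compact_continuous_image
        continuous_intros S)
  ultimately show ?thesis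
    unfolding supp_def by (intro cSUP_upper)
qed

lemma supp_least: "(\<And>z. z \<in> S \<Longrightarrow> u \<bullet> z \<le> b) \<Longrightarrow> supp S u \<le> b"
  by (rule supp_attained[OF S, of u]) metis

lemma supp_scale: "0 \<le> r \<Longrightarrow> supp S (r *\<^sub>R u) = r * supp S u"
proof -
  assume "0 \<le> r"
  obtain z where z: "z \<in> S" "u \<bullet> z = supp S u"
    by (rule supp_attained[OF S])
  have "supp S (r *\<^sub>R u) = (r *\<^sub>R u) \<bullet> z"
    using \<open>0 \<le> r\<close> z supp_upper[of _ u] by (intro supp_eqI) (auto intro: mult_left_mono)
  with z show ?thesis by simp
qed

lemma supp_add_le: "supp S (u + v) \<le> supp S u + supp S v"
  using supp_upper[of _ u] supp_upper[of _ v]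
  by (intro supp_least) (simp add: inner_add_left add_mono)

lemma compact_face: "compact (face S u)"
proof -
  have "face S u = S \<inter> {z. u \<bullet> z = supp S u}"
    by (auto simp: face_def)
  then show ?thesis
    using S by (simp add: compact_Int_closed closed_hyperplane)
qed

lemma face_nonempty: "face S u \<noteq> {}"
  using supp_attained[OF S, of u] by (auto simp: face_def)

lemma face_scale: "0 < r \<Longrightarrow> face S (r *\<^sub>R u) = face S u"
  by (auto simp: face_def supp_scale)

end

lemma supp_mono:
  assumes "compact S" "compact T" "S \<noteq> {}" "S \<subseteq> T"
  shows "supp S u \<le> supp T u"
  using assms by (intro supp_least supp_upper) auto

text \<open>A large multiple of \<open>m\<close> forces the maximisers to be close to the face of \<open>m\<close>, and among the points
  of that face \<open>u\<close> decides.\<close>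

lemma supp_add_scaled_tendsto:
  fixes S :: "'a::real_inner set"
  assumes S: "compact S" "S \<noteq> {}"
  shows "(\<lambda>k. supp S (u + real k *\<^sub>R m) - real k * supp S m) \<longlonglongrightarrow> supp (face S m) u"
proof (rule order_tendstoI)
  let ?s = "supp (face S m) u"
  fix a assume "a < ?s"
  obtain z where "z \<in> face S m" and z: "u \<bullet> z = ?s"
    by (rule supp_attained[OF compact_face[OF S] face_nonempty[OF S]])
  then have "z \<in> S" "m \<bullet> z = supp S m"
    by (auto simp: face_def)
  then have "?s + real k * supp S m \<le> supp S (u + real k *\<^sub>R m)" for k
    using supp_upper[OF S, of z "u + real k *\<^sub>R m"] z by (simp add: inner_add_left)
  with \<open>a < ?s\<close> show "\<forall>\<^sub>F k in sequentially. a < supp S (u + real k *\<^sub>R m) - real k * supp S m"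
    by (intro always_eventually allI) (smt (verit))
next
  let ?s = "supp (face S m) u"
  fix b assume "?s < b"
  define \<epsilon> where "\<epsilon> = (b - ?s) / 2"
  have "0 < \<epsilon>" using \<open>?s < b\<close> by (simp add: \<epsilon>_def)
  \<comment> \<open>Where \<open>u\<close> exceeds \<open>?s\<close> by \<open>\<epsilon>\<close>, compactness keeps \<open>m\<close> a definite amount \<open>\<eta>\<close>
    below its maximum, which a large multiple of \<open>m\<close> turns into an arbitrarily large loss.\<close>
  define T where "T = S \<inter> {z. u \<bullet> z \<ge> ?s + \<epsilon>}"
  have "compact T"
    unfolding T_def using S by (intro compact_Int_closed closed_halfspace_ge)
  have "\<exists>\<eta>>0. \<forall>z\<in>T. m \<bullet> z \<le> supp S m - \<eta>"
  proof (cases "T = {}")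
    case True
    then show ?thesis by (auto intro: exI[of _ 1])
  next
    case False
    obtain y where y: "y \<in> T" "m \<bullet> y = supp T m"
      by (rule supp_attained[OF \<open>compact T\<close> False])
    have "m \<bullet> y \<noteq> supp S m"
    proof
      assume "m \<bullet> y = supp S m"
      with y have "y \<in> face S m"
        by (auto simp: face_def T_def)
      then have "u \<bullet> y \<le> ?s"
        by (rule supp_upper[OF compact_face[OF S] face_nonempty[OF S]])
      with y \<open>0 < \<epsilon>\<close> show False
        by (auto simp: T_def)
    qed
    moreover have "m \<bullet> y \<le> supp S m"
      using y by (intro supp_upper[OF S]) (auto simp: T_def)
    ultimately show ?thesis
      using y supp_upper[OF \<open>compact T\<close> False, of _ m]
      by (intro exI[of _ "supp S m - m \<bullet> y"]) auto
  qed
  then obtain \<eta> where \<eta>: "\<eta> > 0" "\<And>z. z \<in> T \<Longrightarrow> m \<bullet> z \<le> supp S m - \<eta>"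
    by auto
  obtain n where "(supp S u - ?s) / \<eta> \<le> real n"
    using real_arch_simple by blast
  then have "\<forall>\<^sub>F k in sequentially. supp S u - ?s \<le> real k * \<eta>"
    using \<eta>(1) by (intro eventually_sequentiallyI[of n]) (simp add: field_simps, smt (verit) mult_left_mono of_nat_le_iff)
  then show "\<forall>\<^sub>F k in sequentially. supp S (u + real k *\<^sub>R m) - real k * supp S m < b"
  proof eventually_elim
    fix k assume k: "supp S u - ?s \<le> real k * \<eta>"
    have "(u + real k *\<^sub>R m) \<bullet> z \<le> ?s + \<epsilon> + real k * supp S m" if z: "z \<in> S" for z
    proof (cases "z \<in> T")
      case True
      have "real k * (m \<bullet> z) \<le> real k * (supp S m - \<eta>)"
        using \<eta>(2)[OF True] by (intro mult_left_mono) auto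
      moreover have "u \<bullet> z \<le> supp S u"
        using supp_upper[OF S z] .
      ultimately show ?thesis
        using k \<open>0 < \<epsilon>\<close> by (simp add: inner_add_left algebra_simps)
    next
      case False
      have "real k * (m \<bullet> z) \<le> real k * supp S m"
        using supp_upper[OF S z] by (intro mult_left_mono) auto
      with False z show ?thesis
        by (simp add: T_def inner_add_left)
    qed
    then have "supp S (u + real k *\<^sub>R m) \<le> ?s + \<epsilon> + real k * supp S m"
      by (rule supp_least[OF S])
    with \<open>?s < b\<close> show "supp S (u + real k *\<^sub>R m) - real k * supp S m < b"
      by (simp add: \<epsilon>_def field_simps)
  qed
qed

text \<open>The summand of both series. It is the amount by which the supporting half-plane of the mediant
  misses the corner formed by the other two supporting lines.\<close>

definition gap :: "'a::real_inner set \<Rightarrow> 'a \<times> 'a \<Rightarrow> real" where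
  "gap S p = supp S (fst p) + supp S (snd p) - supp S (mediant p)"

text \<open>The sum of the two members of \<open>p\<close> is constant on the face of the mediant, so this is the
  variation of either member along that face.\<close>

definition face_length :: "'a::real_inner set \<Rightarrow> 'a \<times> 'a \<Rightarrow> real" where
  "face_length S p =
     supp (face S (mediant p)) (fst p) + supp (face S (mediant p)) (snd p) - supp S (mediant p)"

text \<open>The decrease of \<open>v\<close> along the supporting line of \<open>u\<close>, from the corner with the supporting line of
  \<open>v\<close> to the nearest point of the face of \<open>u\<close>.\<close>

definition leg :: "'a::real_inner set \<Rightarrow> 'a \<Rightarrow> 'a \<Rightarrow> real" where
  "leg S u v = supp S v - supp (face S u) v"

context
  fixes S :: "'a::real_inner set"
  assumes S: "compact S" "S \<noteq> {}"
begin

lemma gap_nonneg: "0 \<le> gap S p"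
  using supp_add_le[OF S, of "fst p" "snd p"] by (simp add: gap_def mediant_def)

lemma leg_nonneg: "0 \<le> leg S u v"
  using supp_mono[OF compact_face[OF S] S(1) face_nonempty[OF S], of u v]
  by (simp add: leg_def face_def)

lemma supp_on_face: "z \<in> face S u \<Longrightarrow> u \<bullet> z = supp S u"
  by (simp add: face_def)

lemma supp_face_self: "supp (face S u) u = supp S u"
  by (rule supp_attained[OF compact_face[OF S] face_nonempty[OF S], of u u])
    (simp add: face_def)

lemma supp_face_add: "supp (face S u) (u + v) = supp S u + supp (face S u) v"
proof -
  obtain z where z: "z \<in> face S u" "v \<bullet> z = supp (face S u) v"
    by (rule supp_attained[OF compact_face[OF S] face_nonempty[OF S]])
  have "supp (face S u) (u + v) = (u + v) \<bullet> z"
    using z supp_upper[OF compact_face[OF S] face_nonempty[OF S], of _ u v]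
    by (intro supp_eqI) (auto simp: inner_add_left supp_on_face)
  with z show ?thesis
    by (simp add: inner_add_left supp_on_face)
qed

lemma face_length_nonneg: "0 \<le> face_length S p"
  using supp_add_le[OF compact_face[OF S] face_nonempty[OF S], of "mediant p" "fst p" "snd p"]
    supp_face_self[of "mediant p"]
  by (simp add: face_length_def mediant_def)

text \<open>Cutting the corner shortens both legs by the gap. The new edge, whose length is also the gap,
  consists of a leg of either new corner and the face between them.\<close>

lemma leg_split:
  "leg S u v + leg S v u = gap S (u, v) + face_length S (u, v)
     + (leg S u (u + v) + leg S (u + v) u) + (leg S (u + v) v + leg S v (u + v))"
  using supp_face_add[of u v] supp_face_add[of v u]
  by (simp add: leg_def gap_def face_length_def mediant_def add.commute)

text \<open>The sum of the two legs is a potential: by \<open>leg_split\<close> it pays for the gap and for the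
  potentials of both children.\<close>

lemma gap_sum_bounded:
  "(\<Sum>w | length w < n. gap S (farey w (u, v))) \<le> leg S u v + leg S v u"
proof (induction n arbitrary: u v)
  case 0
  then show ?case
    using leg_nonneg by (simp add: add_nonneg_nonneg)
next
  case (Suc n)
  let ?X = "{w :: bool list. length w < n}"
  have fin: "finite ?X"
    by (rule finite_subset[OF _ finite_lists_length_le[of UNIV n]]) auto
  have eq: "{w. length w < Suc n} = insert [] (Cons True ` ?X \<union> Cons False ` ?X)"
  proof (intro subset_antisym subsetI)
    fix w :: "bool list" assume "w \<in> {w. length w < Suc n}"
    then show "w \<in> insert [] (Cons True ` ?X \<union> Cons False ` ?X)"
      by (cases w rule: node.cases) auto
  qed auto
  have "(\<Sum>w | length w < Suc n. gap S (farey w (u, v)))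
        = gap S (u, v) + ((\<Sum>w\<in>Cons True ` ?X. gap S (farey w (u, v)))
            + (\<Sum>w\<in>Cons False ` ?X. gap S (farey w (u, v))))"
    unfolding eq using fin
    by (subst sum.insert) (auto intro!: sum.union_disjoint)
  also have "\<dots> = gap S (u, v) + ((\<Sum>w\<in>?X. gap S (farey w (u, u + v)))
            + (\<Sum>w\<in>?X. gap S (farey w (u + v, v))))"
    by (simp add: sum.reindex)
  also have "\<dots> \<le> gap S (u, v) + ((leg S u (u + v) + leg S (u + v) u)
      + (leg S (u + v) v + leg S v (u + v)))"
    using Suc.IH[of u "u + v"] Suc.IH[of "u + v" v] by linarith
  also have "\<dots> \<le> leg S u v + leg S v u"
    using leg_split[of u v] face_length_nonneg[of "(u, v)"] by linarith
  finally show ?case .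
qed

lemma gap_summable: "(\<lambda>w. gap S (farey w p)) summable_on UNIV"
proof -
  obtain u v where p: "p = (u, v)" by (cases p)
  have "(\<Sum>w\<in>F. gap S (farey w p)) \<le> leg S u v + leg S v u" if "finite F" for F
  proof -
    obtain n where n: "\<forall>w\<in>F. length w \<le> n"
      using finite_nat_set_iff_bounded_le[of "length ` F"] \<open>finite F\<close> by auto
    have "(\<Sum>w\<in>F. gap S (farey w p)) \<le> (\<Sum>w | length w < Suc n. gap S (farey w p))"
      using n finite_subset[OF _ finite_lists_length_le[of "UNIV :: bool set" n]]
      by (intro sum_mono2) (auto simp: gap_nonneg less_Suc_eq_le)
    with gap_sum_bounded[where n = "Suc n" and u = u and v = v] show ?thesis
      unfolding p by linarith
  qed
  then show ?thesis
    by (intro nonneg_bdd_above_summable_on bdd_aboveI2) (auto simp: gap_nonneg)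
qed

text \<open>The cuts that shorten an edge with normal \<open>m\<close> from one side telescope. In the limit they consume the
  whole leg.\<close>

lemma gap_row_has_sum:
  "((\<lambda>k. gap S (u + real k *\<^sub>R m, m)) has_sum leg S m u) UNIV"
proof (rule sums_nonneg_imp_has_sum)
  let ?a = "\<lambda>k. supp S (u + real k *\<^sub>R m) - real k * supp S m"
  have "gap S (u + real k *\<^sub>R m, m) = ?a k - ?a (Suc k)" for k
    by (simp add: gap_def mediant_def algebra_simps)
  moreover have "(\<lambda>k. ?a k - ?a (Suc k)) sums (?a 0 - supp (face S m) u)"
    by (rule telescope_sums'[OF supp_add_scaled_tendsto[OF S]])
  ultimately show "(\<lambda>k. gap S (u + real k *\<^sub>R m, m)) sums leg S m u"
    by (simp add: leg_def)
qed (rule gap_nonneg)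

lemma gap_swap: "gap S (u, v) = gap S (v, u)"
  by (simp add: gap_def mediant_def add.commute)

lemma gap_replicate_sum:
  "(\<Sum>\<^sub>\<infinity>k. gap S (farey (replicate k False) (u, v))) = leg S v u"
  "(\<Sum>\<^sub>\<infinity>k. gap S (farey (replicate k True) (u, v))) = leg S u v"
  using infsumI[OF gap_row_has_sum[of u v]] infsumI[OF gap_row_has_sum[of v u]]
  by (simp_all add: farey_replicate gap_swap[of u])

text \<open>The gap of a word minus the gaps of its two rows of descendants is the length of the face that
  survives. By \<open>summable_word_split\<close> the rows of either kind add up to the sum of all gaps without one
  boundary row, which in turn adds up to a leg of the initial corner.\<close>

theorem gap_sum:
  "(\<lambda>w. face_length S (farey w (u, v))) summable_on UNIV"
  "(\<Sum>\<^sub>\<infinity>w. gap S (farey w (u, v)))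
     = leg S u v + leg S v u - (\<Sum>\<^sub>\<infinity>w. face_length S (farey w (u, v)))"
proof -
  let ?g = "\<lambda>w. gap S (farey w (u, v))"
  let ?r = "\<lambda>b w. \<Sum>\<^sub>\<infinity>k. ?g (w @ (\<not> b) # replicate k b)"
  have r: "?r False w = leg S (mediant (farey w (u, v))) (fst (farey w (u, v)))"
          "?r True w = leg S (mediant (farey w (u, v))) (snd (farey w (u, v)))" for w
    by (cases "farey w (u, v)";
        simp add: farey_append gap_replicate_sum mediant_def)+
  have len: "face_length S (farey w (u, v)) = ?g w - ?r False w - ?r True w" for w
    unfolding r by (simp add: face_length_def gap_def leg_def)
  note split = summable_word_split[OF gap_summable[of "(u, v)"]]
  have "((\<lambda>w. ?g w + - ?r False w + - ?r True w) has_sum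
      (\<Sum>\<^sub>\<infinity>w. ?g w) + - (\<Sum>\<^sub>\<infinity>w. ?r False w) + - (\<Sum>\<^sub>\<infinity>w. ?r True w)) UNIV"
    by (intro has_sum_add has_sum_uminusI has_sum_infsum gap_summable split)
  then have sum: "((\<lambda>w. face_length S (farey w (u, v))) has_sum
      (\<Sum>\<^sub>\<infinity>w. ?g w) - (\<Sum>\<^sub>\<infinity>w. ?r False w) - (\<Sum>\<^sub>\<infinity>w. ?r True w)) UNIV"
    by (simp add: len)
  then show "(\<lambda>w. face_length S (farey w (u, v))) summable_on UNIV"
    by (rule has_sum_imp_summable)
  from infsumI[OF sum] split(2)[of False] split(2)[of True]
  show "(\<Sum>\<^sub>\<infinity>w. ?g w) = leg S u v + leg S v u - (\<Sum>\<^sub>\<infinity>w. face_length S (farey w (u, v)))"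
    by (simp add: gap_replicate_sum)
qed

end

section \<open>Tiling the corner by triangles\<close>

text \<open>Countable additivity for families over an arbitrary countable index type; the embedding into the
  natural numbers is completed by empty sets.\<close>

lemma has_sum_measure_disjoint:
  fixes X :: "'i::countable \<Rightarrow> 'a set"
  assumes "\<And>i. X i \<in> sets M" "disjoint_family X" "emeasure M (\<Union>i. X i) \<noteq> \<infinity>"
  shows "((\<lambda>i. measure M (X i)) has_sum measure M (\<Union>i. X i)) UNIV"
proof -
  define Y where "Y n = (if n \<in> range (to_nat :: 'i \<Rightarrow> nat) then X (from_nat n) else {})" for n
  have Y_to_nat: "Y (to_nat i) = X i" for i
    by (simp add: Y_def)
  have Un: "(\<Union>n. Y n) = (\<Union>i. X i)"
    by (auto simp: Y_def split: if_splits)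
  have disjoint: "disjoint_family Y"
    unfolding disjoint_family_on_def
  proof (intro ballI impI)
    fix m n :: nat assume "m \<noteq> n"
    show "Y m \<inter> Y n = {}"
    proof (cases "m \<in> range (to_nat :: 'i \<Rightarrow> nat) \<and> n \<in> range (to_nat :: 'i \<Rightarrow> nat)")
      case True
      then obtain i j :: 'i where "m = to_nat i" "n = to_nat j"
        by blast
      with \<open>m \<noteq> n\<close> show ?thesis
        using disjoint_family_onD[OF assms(2), of i j] by (auto simp: Y_to_nat)
    next
      case False
      then show ?thesis by (auto simp: Y_def)
    qed
  qed
  have sets: "range Y \<subseteq> sets M"
    using assms(1) by (auto simp: Y_def)
  have finite: "emeasure M (\<Union>n. Y n) \<noteq> \<infinity>"
    using assms(3) unfolding Un .
  have "(\<lambda>n. measure M (Y n)) sums measure M (\<Union>n. Y n)"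
    by (rule measure_UNION[OF sets disjoint finite])
  then have "((\<lambda>n. measure M (Y n)) has_sum measure M (\<Union>i. X i)) UNIV"
    unfolding Un by (rule sums_nonneg_imp_has_sum) simp
  then have "((\<lambda>n. measure M (Y n)) has_sum measure M (\<Union>i. X i)) (range (to_nat :: 'i \<Rightarrow> nat))"
    by (subst has_sum_cong_neutral[where T = UNIV and g = "\<lambda>n. measure M (Y n)"])
      (auto simp: Y_def)
  then show ?thesis
    by (subst (asm) has_sum_reindex) (auto simp: o_def Y_to_nat)
qed

text \<open>The point \<open>z\<close> lies strictly beyond the supporting line with normal \<open>u\<close>. For fixed \<open>z\<close> these normals form
  a convex cone, by sublinearity of the support function.\<close>

definition exceeds :: "'a::real_inner set \<Rightarrow> 'a \<Rightarrow> 'a \<Rightarrow> bool" where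
  "exceeds S z u \<longleftrightarrow> supp S u < u \<bullet> z"

text \<open>The triangle cut off by the mediant, without its side on the cutting line. This choice of
  boundary makes the triangles of the tree pairwise disjoint.\<close>

definition cut_triangle :: "'a::real_inner set \<Rightarrow> 'a \<times> 'a \<Rightarrow> 'a set" where
  "cut_triangle S p =
     {z. \<not> exceeds S z (fst p) \<and> \<not> exceeds S z (snd p) \<and> exceeds S z (mediant p)}"

definition corner_region :: "'a::real_inner set \<Rightarrow> 'a \<Rightarrow> 'a \<Rightarrow> 'a set" where
  "corner_region S u v = {z. \<not> exceeds S z u \<and> \<not> exceeds S z v \<and>
     (\<exists>\<alpha> \<beta>. 0 \<le> \<alpha> \<and> 0 \<le> \<beta> \<and> exceeds S z (\<alpha> *\<^sub>R u + \<beta> *\<^sub>R v))}"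

context
  fixes S :: "'a::real_inner set"
  assumes S: "compact S" "S \<noteq> {}"
begin

lemma exceeds_scale: "0 < r \<Longrightarrow> exceeds S z (r *\<^sub>R u) \<longleftrightarrow> exceeds S z u"
  by (simp add: exceeds_def supp_scale[OF S])

lemma exceeds_add: "exceeds S z u \<Longrightarrow> exceeds S z v \<Longrightarrow> exceeds S z (u + v)"
  using supp_add_le[OF S, of u v] by (simp add: exceeds_def inner_add_left)

text \<open>The cone of exceeding normals is open. A large multiple of a real combination can therefore be
  rounded down to one with natural coefficients, and \<open>C\<close> bounds the loss.\<close>

lemma exceeds_nat_combination:
  assumes "exceeds S z (\<alpha> *\<^sub>R u + \<beta> *\<^sub>R v)" "0 \<le> \<alpha>" "0 \<le> \<beta>"
  shows "\<exists>a b :: nat. exceeds S z (real a *\<^sub>R u + real b *\<^sub>R v)"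
proof -
  let ?w = "\<alpha> *\<^sub>R u + \<beta> *\<^sub>R v"
  define e where "e = ?w \<bullet> z - supp S ?w"
  define C where "C = \<bar>u \<bullet> z + supp S (- u)\<bar> + \<bar>v \<bullet> z + supp S (- v)\<bar>"
  have "e > 0"
    using assms by (simp add: e_def exceeds_def)
  then obtain n :: nat where n: "C < real n * e"
    using reals_Archimedean3 by blast
  define a where "a = nat \<lfloor>real n * \<alpha>\<rfloor>"
  define b where "b = nat \<lfloor>real n * \<beta>\<rfloor>"
  define s where "s = real n * \<alpha> - real a"
  define t where "t = real n * \<beta> - real b"
  have st: "0 \<le> s" "s \<le> 1" "0 \<le> t" "t \<le> 1"
    using assms(2,3) unfolding s_def t_def a_def b_def
    by (simp_all; linarith)+
  let ?x = "real a *\<^sub>R u + real b *\<^sub>R v"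
  have x: "?x = real n *\<^sub>R ?w + (s *\<^sub>R (- u) + t *\<^sub>R (- v))"
    by (simp add: s_def t_def algebra_simps)
  have "supp S ?x \<le> supp S (real n *\<^sub>R ?w) + (supp S (s *\<^sub>R (- u)) + supp S (t *\<^sub>R (- v)))"
    unfolding x using supp_add_le[OF S] by (meson add_left_mono order_trans)
  also have "\<dots> = real n * supp S ?w + (s * supp S (- u) + t * supp S (- v))"
    using st by (simp only: supp_scale[OF S] of_nat_0_le_iff)
  finally have 1: "supp S ?x \<le> real n * supp S ?w + (s * supp S (- u) + t * supp S (- v))" .
  have 2: "?x \<bullet> z = real n * (?w \<bullet> z) - s * (u \<bullet> z) - t * (v \<bullet> z)"
    unfolding x by (simp add: inner_simps)
  have aux: "r * x \<le> \<bar>x\<bar>" if "0 \<le> r" "r \<le> 1" for r x :: real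
    using that mult_left_mono[of x "\<bar>x\<bar>" r] mult_right_mono[of r 1 "\<bar>x\<bar>"] by linarith
  have "s * (u \<bullet> z + supp S (- u)) \<le> 1 * \<bar>u \<bullet> z + supp S (- u)\<bar>"
       "t * (v \<bullet> z + supp S (- v)) \<le> 1 * \<bar>v \<bullet> z + supp S (- v)\<bar>"
    using st by (auto intro: aux)
  then have "s * (u \<bullet> z + supp S (- u)) + t * (v \<bullet> z + supp S (- v)) \<le> C"
    by (simp add: C_def)
  with n 1 2 have "exceeds S z ?x"
    by (simp add: exceeds_def e_def algebra_simps)
  then show ?thesis
    by blast
qed

text \<open>A triangle deep in the tree stays within the initial corner. If the point also exceeded the
  outer member of the pair, then by convexity it would exceed the parent mediant, which lies between that
  member and the mediant of the word.\<close>

lemma cut_triangle_farey: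
  assumes "z \<in> cut_triangle S (farey w (u, v))"
  shows "\<not> exceeds S z u \<and> \<not> exceeds S z v \<and> exceeds S z (mediant (farey w (u, v)))"
  using assms
proof (induction w arbitrary: u v rule: node.induct)
  case 1
  then show ?case by (simp add: cut_triangle_def)
next
  case (2 w)
  let ?x = "mediant (farey w (u, u + v))"
  let ?a = "real (fst (node w))" and ?b = "real (snd (node w))"
  from 2 have IH: "\<not> exceeds S z u" "\<not> exceeds S z (u + v)" "exceeds S z ?x"
    by (auto dest: "2.IH")
  have "\<not> exceeds S z v"
  proof
    assume "exceeds S z v"
    then have "exceeds S z (?x + ?a *\<^sub>R v)"
      using IH(3) node_pos[of w] by (intro exceeds_add) (auto simp: exceeds_scale)
    \<comment> \<open>The mediant is \<open>a u + b (u + v)\<close>, so adding \<open>a v\<close> to it gives a multiple of the parent mediant.\<close>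
    moreover have "?x + ?a *\<^sub>R v = (?a + ?b) *\<^sub>R (u + v)"
      by (simp add: mediant_farey algebra_simps)
    ultimately show False
      using IH(2) node_pos[of w] by (simp add: exceeds_scale)
  qed
  with IH show ?case by simp
next
  case (3 w)
  let ?x = "mediant (farey w (u + v, v))"
  let ?a = "real (fst (node w))" and ?b = "real (snd (node w))"
  from 3 have IH: "\<not> exceeds S z v" "\<not> exceeds S z (u + v)" "exceeds S z ?x"
    by (auto dest: "3.IH")
  have "\<not> exceeds S z u"
  proof
    assume "exceeds S z u"
    then have "exceeds S z (?x + ?b *\<^sub>R u)"
      using IH(3) node_pos[of w] by (intro exceeds_add) (auto simp: exceeds_scale)
    moreover have "?x + ?b *\<^sub>R u = (?a + ?b) *\<^sub>R (u + v)"
      by (simp add: mediant_farey algebra_simps)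
    ultimately show False
      using IH(2) node_pos[of w] by (simp add: exceeds_scale)
  qed
  with IH show ?case by simp
qed

text \<open>A mediant separates its two subtrees, so a convex cone that meets both sides contains it.\<close>

lemma not_exceeds_both_sides:
  assumes "exceeds S z (mediant (farey w (u, u + v)))"
    and "exceeds S z (mediant (farey w' (u + v, v)))"
  shows "exceeds S z (u + v)"
proof -
  let ?a = "real (fst (node w))" and ?b = "real (snd (node w))"
  let ?a' = "real (fst (node w'))" and ?b' = "real (snd (node w'))"
  have pos: "?a > 0" "?b > 0" "?a' > 0" "?b' > 0"
    using node_pos by auto
  have "exceeds S z (?b' *\<^sub>R mediant (farey w (u, u + v)) + ?a *\<^sub>R mediant (farey w' (u + v, v)))"
    using assms pos by (intro exceeds_add) (auto simp: exceeds_scale)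
  moreover have "?b' *\<^sub>R mediant (farey w (u, u + v)) + ?a *\<^sub>R mediant (farey w' (u + v, v))
      = (?a * ?b' + ?b * ?b' + ?a * ?a') *\<^sub>R (u + v)"
    by (simp add: mediant_farey algebra_simps)
  ultimately show ?thesis
    using pos by (simp add: exceeds_scale add_pos_pos)
qed

lemma disjoint_cut_triangles:
  "z \<in> cut_triangle S (farey w (u, v)) \<Longrightarrow> z \<in> cut_triangle S (farey w' (u, v)) \<Longrightarrow> w = w'"
proof (induction w arbitrary: w' u v rule: node.induct)
  case 1
  show ?case
  proof (cases w' rule: node.cases)
    case (2 w'')
    then show ?thesis
      using 1 cut_triangle_farey[of z w'' u "u + v"]
      by (simp add: cut_triangle_def[of S "(u, v)"] mediant_def)
  next
    case (3 w'')
    then show ?thesis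
      using 1 cut_triangle_farey[of z w'' "u + v" v]
      by (simp add: cut_triangle_def[of S "(u, v)"] mediant_def)
  qed simp
next
  case (2 w)
  then have w: "\<not> exceeds S z (u + v)" "exceeds S z (mediant (farey w (u, u + v)))"
    using cut_triangle_farey[of z w u "u + v"] by simp_all
  show ?case
  proof (cases w' rule: node.cases)
    case 1
    with w 2 show ?thesis
      by (simp add: cut_triangle_def[of S "(u, v)"] mediant_def)
  next
    case (2 w'')
    with "2.IH"[of u "u + v" w''] "2.prems" show ?thesis by simp
  next
    case (3 w'')
    with w "2.prems" not_exceeds_both_sides[of z w u v w''] show ?thesis
      using cut_triangle_farey[of z w'' "u + v" v] by simp
  qed
next
  case (3 w)
  then have w: "\<not> exceeds S z (u + v)" "exceeds S z (mediant (farey w (u + v, v)))"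
    using cut_triangle_farey[of z w "u + v" v] by simp_all
  show ?case
  proof (cases w' rule: node.cases)
    case 1
    with w 3 show ?thesis
      by (simp add: cut_triangle_def[of S "(u, v)"] mediant_def)
  next
    case (2 w'')
    with w "3.prems" not_exceeds_both_sides[of z w'' u v w] show ?thesis
      using cut_triangle_farey[of z w'' u "u + v"] by simp
  next
    case (3 w'')
    with "3.IH"[of "u + v" v w''] "3.prems" show ?thesis by simp
  qed
qed

text \<open>Euclid's algorithm on the coefficients of an exceeding normal descends to the first node whose
  mediant is exceeded.\<close>

lemma corner_region_covered:
  assumes "\<not> exceeds S z u" "\<not> exceeds S z v"
    and "exceeds S z (real a *\<^sub>R u + real b *\<^sub>R v)"
  shows "\<exists>w. z \<in> cut_triangle S (farey w (u, v))"
  using assms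
proof (induction "a + b" arbitrary: a b u v rule: less_induct)
  case less
  show ?case
  proof (cases "exceeds S z (u + v)")
    case True
    with less.prems have "z \<in> cut_triangle S (farey [] (u, v))"
      by (simp add: cut_triangle_def mediant_def)
    then show ?thesis ..
  next
    case False
    have "a \<noteq> 0"
    proof
      assume "a = 0"
      with less.prems supp_scale[OF S, of 0 v] show False
        by (cases "b = 0") (simp_all add: exceeds_scale, simp add: exceeds_def)
    qed
    have "b \<noteq> 0"
    proof
      assume "b = 0"
      with less.prems supp_scale[OF S, of 0 v] show False
        by (cases "a = 0") (simp_all add: exceeds_scale, simp add: exceeds_def)
    qed
    show ?thesis
    proof (cases "b \<le> a")
      case True
      then have "real a *\<^sub>R u + real b *\<^sub>R v = real (a - b) *\<^sub>R u + real b *\<^sub>R (u + v)"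
        by (simp add: of_nat_diff algebra_simps)
      with less.prems have "exceeds S z (real (a - b) *\<^sub>R u + real b *\<^sub>R (u + v))"
        by simp
      then obtain w where "z \<in> cut_triangle S (farey w (u, u + v))"
        using less.hyps[of "a - b" b u "u + v"] less.prems False True \<open>b \<noteq> 0\<close> by auto
      then have "z \<in> cut_triangle S (farey (True # w) (u, v))"
        by simp
      then show ?thesis ..
    next
      case False
      then have "real a *\<^sub>R u + real b *\<^sub>R v = real a *\<^sub>R (u + v) + real (b - a) *\<^sub>R v"
        by (simp add: of_nat_diff algebra_simps)
      with less.prems have "exceeds S z (real a *\<^sub>R (u + v) + real (b - a) *\<^sub>R v)"
        by simp
      then obtain w where "z \<in> cut_triangle S (farey w (u + v, v))"
        using less.hyps[of a "b - a" "u + v" v] less.prems \<open>\<not> exceeds S z (u + v)\<close> False \<open>a \<noteq> 0\<close>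
        by auto
      then have "z \<in> cut_triangle S (farey (False # w) (u, v))"
        by simp
      then show ?thesis ..
    qed
  qed
qed

lemma corner_region_eq_Union:
  "corner_region S u v = (\<Union>w. cut_triangle S (farey w (u, v)))"
proof (intro subset_antisym subsetI)
  fix z assume "z \<in> corner_region S u v"
  then obtain \<alpha> \<beta> where z: "\<not> exceeds S z u" "\<not> exceeds S z v"
    and *: "exceeds S z (\<alpha> *\<^sub>R u + \<beta> *\<^sub>R v)" "0 \<le> \<alpha>" "0 \<le> \<beta>"
    unfolding corner_region_def by auto
  obtain a b :: nat where "exceeds S z (real a *\<^sub>R u + real b *\<^sub>R v)"
    using exceeds_nat_combination[OF *] by auto
  from corner_region_covered[OF z this]
  show "z \<in> (\<Union>w. cut_triangle S (farey w (u, v)))"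
    by auto
next
  fix z assume "z \<in> (\<Union>w. cut_triangle S (farey w (u, v)))"
  then obtain w where w: "z \<in> cut_triangle S (farey w (u, v))" by auto
  have "\<exists>\<alpha> \<beta>. 0 \<le> \<alpha> \<and> 0 \<le> \<beta> \<and> exceeds S z (\<alpha> *\<^sub>R u + \<beta> *\<^sub>R v)"
    using cut_triangle_farey[OF w]
    by (intro exI[of _ "real (fst (node w))"] exI[of _ "real (snd (node w))"])
      (simp add: mediant_farey)
  with cut_triangle_farey[OF w] show "z \<in> corner_region S u v"
    by (simp add: corner_region_def)
qed

end

lemma real2_eqI:
  assumes "det2 u v \<noteq> 0" "u \<bullet> z = u \<bullet> z'" "v \<bullet> z = v \<bullet> z'"
  shows "z = z'"
proof -
  have "det2 u v * (z$1 - z'$1) = v$2 * (u \<bullet> z - u \<bullet> z') - u$2 * (v \<bullet> z - v \<bullet> z')"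
       "det2 u v * (z$2 - z'$2) = u$1 * (v \<bullet> z - v \<bullet> z') - v$1 * (u \<bullet> z - u \<bullet> z')"
    by (simp_all add: det2_def inner_vec_def sum_2 algebra_simps)
  with assms show ?thesis
    by (simp add: vec_eq_iff forall_2)
qed

text \<open>Cramer's rule for the point with prescribed values \<open>s\<close> and \<open>t\<close> of the functionals \<open>u\<close> and \<open>v\<close>.\<close>

definition dual_point :: "real^2 \<Rightarrow> real^2 \<Rightarrow> real \<Rightarrow> real \<Rightarrow> real^2" where
  "dual_point u v s t =
     vector [(s * v$2 - t * u$2) / det2 u v, (t * u$1 - s * v$1) / det2 u v]"

lemma inner_dual_point:
  assumes "det2 u v \<noteq> 0"
  shows "u \<bullet> dual_point u v s t = s" "v \<bullet> dual_point u v s t = t"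
proof -
  have "u \<bullet> dual_point u v s t = (u$1 * (s * v$2 - t * u$2) + u$2 * (t * u$1 - s * v$1)) / det2 u v"
       "v \<bullet> dual_point u v s t = (v$1 * (s * v$2 - t * u$2) + v$2 * (t * u$1 - s * v$1)) / det2 u v"
    by (simp_all add: dual_point_def inner_vec_def sum_2 add_divide_distrib)
  moreover have "u$1 * (s * v$2 - t * u$2) + u$2 * (t * u$1 - s * v$1) = s * det2 u v"
       "v$1 * (s * v$2 - t * u$2) + v$2 * (t * u$1 - s * v$1) = t * det2 u v"
    by (simp_all add: det2_def algebra_simps)
  ultimately show "u \<bullet> dual_point u v s t = s" "v \<bullet> dual_point u v s t = t"
    using assms by simp_all
qed

lemma closed_triangle_eq_hull:
  assumes D: "det2 u v \<noteq> 0" and d: "0 \<le> d"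
  shows "{z. u \<bullet> z \<le> s \<and> v \<bullet> z \<le> t \<and> s + t - d \<le> (u + v) \<bullet> z}
    = convex hull {dual_point u v s t, dual_point u v s (t - d), dual_point u v (s - d) t}"
proof (intro subset_antisym subsetI)
  note ip = inner_dual_point[OF D]
  fix z assume "z \<in> {z. u \<bullet> z \<le> s \<and> v \<bullet> z \<le> t \<and> s + t - d \<le> (u + v) \<bullet> z}"
  then have z: "u \<bullet> z \<le> s" "v \<bullet> z \<le> t" "s + t - d \<le> u \<bullet> z + v \<bullet> z"
    by (auto simp: inner_add_left)
  show "z \<in> convex hull {dual_point u v s t, dual_point u v s (t - d), dual_point u v (s - d) t}"
  proof (cases "d = 0")
    case True
    with z have "z = dual_point u v s t"
      by (intro real2_eqI[OF D]) (auto simp: ip)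
    then show ?thesis
      by (simp add: hull_inc)
  next
    case False
    with d have "d > 0" by simp
    let ?b = "(t - v \<bullet> z) / d" and ?c = "(s - u \<bullet> z) / d"
    have bc: "?b * d = t - v \<bullet> z" "?c * d = s - u \<bullet> z"
      using \<open>d > 0\<close> by simp_all
    have combination: "(1 - b - c) * x + b * x + c * (x - d) = x - c * d"
      "(1 - b - c) * x + b * (x - d) + c * x = x - b * d" for b c x :: real
      by algebra+
    have "z = (1 - ?b - ?c) *\<^sub>R dual_point u v s t + ?b *\<^sub>R dual_point u v s (t - d)
        + ?c *\<^sub>R dual_point u v (s - d) t"
      by (intro real2_eqI[OF D])
        (simp_all only: inner_add_right inner_scaleR_right ip combination bc)
    moreover have "1 - ?b - ?c = (d - (t - v \<bullet> z) - (s - u \<bullet> z)) / d"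
      using \<open>d > 0\<close> by (simp add: diff_divide_distrib)
    then have "0 \<le> ?b" "0 \<le> ?c" "0 \<le> 1 - ?b - ?c"
      using z \<open>d > 0\<close> by simp_all
    ultimately show ?thesis
      unfolding convex_hull_3 by (intro CollectI exI[of _ "1 - ?b - ?c"] exI[of _ ?b] exI[of _ ?c]) simp
  qed
next
  note ip = inner_dual_point[OF D]
  fix z assume "z \<in> convex hull {dual_point u v s t, dual_point u v s (t - d), dual_point u v (s - d) t}"
  moreover have "convex hull {dual_point u v s t, dual_point u v s (t - d), dual_point u v (s - d) t}
     \<subseteq> {z. u \<bullet> z \<le> s} \<inter> {z. v \<bullet> z \<le> t} \<inter> {z. (u + v) \<bullet> z \<ge> s + t - d}"
    using d by (intro hull_minimal convex_Int convex_halfspace_le convex_halfspace_ge)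
      (auto simp: inner_add_left ip)
  ultimately show "z \<in> {z. u \<bullet> z \<le> s \<and> v \<bullet> z \<le> t \<and> s + t - d \<le> (u + v) \<bullet> z}"
    by auto
qed

lemma measure_cut_triangle:
  fixes S :: "(real^2) set"
  assumes S: "compact S" "S \<noteq> {}" and D: "det2 (fst p) (snd p) > 0"
  shows "cut_triangle S p \<in> sets lebesgue"
    and "measure lebesgue (cut_triangle S p) = (gap S p)\<^sup>2 / (2 * det2 (fst p) (snd p))"
proof -
  define u v where uv: "u = fst p" "v = snd p"
  define s t d where std: "s = supp S u" "t = supp S v" "d = gap S p"
  have det: "det2 u v \<noteq> 0" using D by (simp add: uv)
  have d: "0 \<le> d" using gap_nonneg[OF S] by (simp add: std)
  let ?T = "convex hull {dual_point u v s t, dual_point u v s (t - d), dual_point u v (s - d) t}"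
  let ?H = "{z. (u + v) \<bullet> z = supp S (u + v)}"
  have eq: "cut_triangle S p = ?T - ?H"
    unfolding closed_triangle_eq_hull[OF det d, symmetric]
    by (auto simp: cut_triangle_def exceeds_def mediant_def uv std gap_def)
  have "u + v \<noteq> 0"
    using det2_nonzero(3)[OF det] .
  then have H: "?H \<in> null_sets lebesgue"
    by (simp add: negligible_hyperplane flip: negligible_iff_null_sets)
  have T: "?T \<in> sets lebesgue"
    by (intro lmeasurable_compact[THEN fmeasurableD] compact_convex_hull) simp
  show "cut_triangle S p \<in> sets lebesgue"
    unfolding eq using H T by (auto intro: sets.Diff)
  have "measure lebesgue (cut_triangle S p) = measure lebesgue ?T"
    unfolding eq by (rule measure_Diff_null_set[OF T H])
  also have "\<dots> = measure lborel ?T"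
    by (intro measure_completion) (simp add: compact_imp_closed compact_convex_hull borel_closed)
  also have "\<dots> = \<bar>d\<^sup>2 / det2 u v\<bar> / 2"
  proof -
    have "(d * v$2 / x) * (d * u$1 / x) - (d * u$2 / x) * (d * v$1 / x)
       = d\<^sup>2 * (u$1 * v$2 - u$2 * v$1) / x\<^sup>2" for x
      by (simp add: power2_eq_square diff_divide_distrib right_diff_distrib mult_ac)
    then have "(d * v$2 / det2 u v) * (d * u$1 / det2 u v) - (d * u$2 / det2 u v) * (d * v$1 / det2 u v)
       = d\<^sup>2 * det2 u v / (det2 u v)\<^sup>2"
      by (simp only: det2_def)
    also have "\<dots> = d\<^sup>2 / det2 u v"
      using det by (simp add: power2_eq_square)
    finally have *: "(d * v$2 / det2 u v) * (d * u$1 / det2 u v)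
        - (d * u$2 / det2 u v) * (d * v$1 / det2 u v) = d\<^sup>2 / det2 u v" .
    show ?thesis
      unfolding content_triangle *[symmetric]
      by (simp add: dual_point_def diff_divide_distrib[symmetric] algebra_simps)
  qed
  finally show "measure lebesgue (cut_triangle S p) = (gap S p)\<^sup>2 / (2 * det2 (fst p) (snd p))"
    using D by (simp add: std uv)
qed

text \<open>The triangles of the tree tile the region. Its boundedness makes the measure finite, as countable
  additivity of real-valued measures requires.\<close>

theorem gap_square_has_sum:
  fixes S :: "(real^2) set"
  assumes S: "compact S" "S \<noteq> {}" and D: "det2 u v > 0"
    and bd: "bounded (corner_region S u v)"
  shows "((\<lambda>w. (gap S (farey w (u, v)))\<^sup>2 / (2 * det2 u v))
           has_sum measure lebesgue (corner_region S u v)) UNIV"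
    and "corner_region S u v \<in> sets lebesgue"
proof -
  have det: "det2 (fst (farey w (u, v))) (snd (farey w (u, v))) = det2 u v" for w
    by (simp add: det2_farey)
  have m: "cut_triangle S (farey w (u, v)) \<in> sets lebesgue"
    "measure lebesgue (cut_triangle S (farey w (u, v))) = (gap S (farey w (u, v)))\<^sup>2 / (2 * det2 u v)"
    for w
    using measure_cut_triangle[OF S, of "farey w (u, v)"] D by (simp_all add: det)
  have U: "corner_region S u v = (\<Union>w. cut_triangle S (farey w (u, v)))"
    by (rule corner_region_eq_Union[OF S])
  show meas: "corner_region S u v \<in> sets lebesgue"
    unfolding U by (intro sets.countable_UN'[of UNIV]) (auto simp: m)
  have "emeasure lebesgue (corner_region S u v) \<noteq> \<infinity>"
    using fmeasurableD2[OF bounded_set_imp_lmeasurable[OF bd meas]] by simp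
  then have "((\<lambda>w. measure lebesgue (cut_triangle S (farey w (u, v))))
      has_sum measure lebesgue (corner_region S u v)) UNIV"
    unfolding U using disjoint_cut_triangles[OF S]
    by (intro has_sum_measure_disjoint) (simp_all add: m disjoint_family_on_def, blast)
  then show "((\<lambda>w. (gap S (farey w (u, v)))\<^sup>2 / (2 * det2 u v))
           has_sum measure lebesgue (corner_region S u v)) UNIV"
    by (simp add: m)
qed

section \<open>The region enclosed by a convex arc and two supporting lines\<close>

lemma det2_decompose:
  assumes "det2 u v \<noteq> 0"
  obtains \<alpha> \<beta> where "w = \<alpha> *\<^sub>R u + \<beta> *\<^sub>R v"
proof -
  have "det2 u v *\<^sub>R w = det2 w v *\<^sub>R u + det2 u w *\<^sub>R v"
    by (simp add: vec_eq_iff forall_2 det2_def algebra_simps)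
  then have "(1 / det2 u v) *\<^sub>R (det2 u v *\<^sub>R w)
      = (1 / det2 u v) *\<^sub>R (det2 w v *\<^sub>R u + det2 u w *\<^sub>R v)"
    by simp
  then have "w = (1 / det2 u v) *\<^sub>R (det2 w v *\<^sub>R u + det2 u w *\<^sub>R v)"
    using assms by simp
  then show ?thesis
    using that[of "det2 w v / det2 u v" "det2 u w / det2 u v"] by (simp add: scaleR_add_right)
qed

lemma closed_segmentI2:
  assumes "det2 u v \<noteq> 0" "u \<bullet> z = u \<bullet> P" "u \<bullet> Q = u \<bullet> P" "v \<bullet> Q \<le> v \<bullet> z" "v \<bullet> z \<le> v \<bullet> P"
  shows "z \<in> closed_segment P Q"
proof (cases "v \<bullet> Q = v \<bullet> P")
  case True
  then have "z = P"
    using assms by (intro real2_eqI[OF assms(1)]) auto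
  then show ?thesis by simp
next
  case False
  define t where "t = (v \<bullet> P - v \<bullet> z) / (v \<bullet> P - v \<bullet> Q)"
  have t: "t * (v \<bullet> P - v \<bullet> Q) = v \<bullet> P - v \<bullet> z"
    using False by (simp add: t_def)
  have "0 \<le> t" "t \<le> 1"
    using assms False by (auto simp: t_def field_simps)
  moreover have "z = (1 - t) *\<^sub>R P + t *\<^sub>R Q"
    using assms t by (intro real2_eqI[OF assms(1)]) (auto simp: inner_add_right algebra_simps)
  ultimately show ?thesis
    by (auto simp: in_segment)
qed

lemma convex_on_supp:
  assumes "compact S" "S \<noteq> {}"
  shows "convex_on UNIV (supp S)"
proof (rule convex_onI)
  fix t x y assume "0 < t" "t < (1::real)"
  then show "supp S ((1 - t) *\<^sub>R x + t *\<^sub>R y) \<le> (1 - t) * supp S x + t * supp S y"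
    using supp_add_le[OF assms, of "(1 - t) *\<^sub>R x" "t *\<^sub>R y"] by (simp add: supp_scale[OF assms])
qed simp

lemma continuous_on_supp:
  fixes S :: "'a::euclidean_space set"
  assumes "compact S" "S \<noteq> {}"
  shows "continuous_on X (supp S)"
  using convex_on_continuous[OF open_UNIV convex_on_supp[OF assms]] continuous_on_subset by blast

text \<open>The supporting line cuts the hull in a face, and a face of the hull of a compact set is the hull of
  the points of the set that it contains.\<close>

lemma in_hull_face:
  fixes S :: "'a::euclidean_space set"
  assumes S: "compact S" "S \<noteq> {}" and z: "z \<in> convex hull S" "u \<bullet> z = supp S u"
  shows "z \<in> convex hull (face S u)"
proof -
  have "convex hull S \<subseteq> {x. u \<bullet> x \<le> supp S u}"
    using supp_upper[OF S] by (intro hull_minimal convex_halfspace_le) auto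
  then have "(convex hull S \<inter> {x. u \<bullet> x = supp S u}) face_of (convex hull S)"
    by (intro face_of_Int_supporting_hyperplane_le) auto
  then obtain S' where S': "S' \<subseteq> S" "convex hull S \<inter> {x. u \<bullet> x = supp S u} = convex hull S'"
    using face_of_convex_hull_subset[OF S(1)] by metis
  then have "S' \<subseteq> face S u"
    using hull_subset[of S' convex] by (auto simp: face_def)
  then show ?thesis
    using S' z hull_mono[of S' "face S u" convex] by auto
qed

text \<open>An unbounded ray in the complement of \<open>J\<close> makes the component of its starting point unbounded.\<close>

lemma not_inside_if_ray:
  fixes d :: "'a::real_normed_vector"
  assumes "d \<noteq> 0" "\<And>t. 0 \<le> t \<Longrightarrow> z + t *\<^sub>R d \<notin> J"
  shows "z \<notin> inside J"
proof
  assume "z \<in> inside J"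
  then have bd: "bounded (connected_component_set (- J) z)"
    by (simp add: inside_def)
  let ?R = "(\<lambda>t. z + t *\<^sub>R d) ` {0..}"
  have "connected ?R"
    by (intro connected_continuous_image continuous_intros) (simp add: connected_Ici)
  moreover have "z \<in> ?R"
    by (rule image_eqI[of _ _ 0]) auto
  moreover have "?R \<subseteq> - J"
    using assms(2) by auto
  ultimately have "?R \<subseteq> connected_component_set (- J) z"
    by (intro connected_component_maximal)
  with bd have "bounded ?R"
    using bounded_subset by blast
  then obtain B where B: "\<And>x. x \<in> ?R \<Longrightarrow> norm x \<le> B"
    by (auto simp: bounded_iff)
  define t where "t = (B + norm z + 1) / norm d"
  have "0 \<le> B"
    using B[of z] \<open>z \<in> ?R\<close> norm_ge_zero[of z] by linarith
  then have "t \<ge> 0"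
    by (simp add: t_def)
  then have "norm (z + t *\<^sub>R d) \<le> B"
    by (intro B) auto
  moreover have "norm (t *\<^sub>R d) \<le> norm (z + t *\<^sub>R d) + norm z"
    using norm_triangle_ineq4[of "z + t *\<^sub>R d" z] by simp
  moreover have "norm (t *\<^sub>R d) = B + norm z + 1"
    using assms(1) \<open>0 \<le> B\<close> by (simp add: t_def)
  ultimately show False by simp
qed

text \<open>The properties of the curve on which both identities rest, stated without reference to a
  parametrisation. The faces with normals in the cone of \<open>v1\<close> and \<open>v2\<close> are segments and cover the curve,
  which runs from \<open>A2\<close> to \<open>A1\<close>. The assumptions \<open>first\<close> and \<open>last\<close> say that no part of the faces of
  \<open>v1\<close> and \<open>v2\<close> lies beyond these endpoints.\<close>

locale convex_arc =
  fixes \<Gamma> :: "(real^2) set" and v1 v2 A1 A2 A12 :: "real^2"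
  assumes compact: "compact \<Gamma>"
    and det_pos: "det2 v1 v2 > 0"
    and A1: "A1 \<in> face \<Gamma> v1" and A2: "A2 \<in> face \<Gamma> v2"
    and apex: "v1 \<bullet> A12 = supp \<Gamma> v1" "v2 \<bullet> A12 = supp \<Gamma> v2"
    and convex_face: "\<And>\<alpha> \<beta>. 0 \<le> \<alpha> \<Longrightarrow> 0 \<le> \<beta> \<Longrightarrow> \<alpha> + \<beta> > 0 \<Longrightarrow> convex (face \<Gamma> (\<alpha> *\<^sub>R v1 + \<beta> *\<^sub>R v2))"
    and in_face: "\<And>z. z \<in> \<Gamma> \<Longrightarrow>
      \<exists>\<alpha> \<beta>. 0 \<le> \<alpha> \<and> 0 \<le> \<beta> \<and> \<alpha> + \<beta> > 0 \<and> z \<in> face \<Gamma> (\<alpha> *\<^sub>R v1 + \<beta> *\<^sub>R v2)"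
    and first: "\<And>z. z \<in> face \<Gamma> v1 \<Longrightarrow> v2 \<bullet> A1 \<le> v2 \<bullet> z"
    and last: "\<And>z. z \<in> face \<Gamma> v2 \<Longrightarrow> v1 \<bullet> A2 \<le> v1 \<bullet> z"
begin

lemma nonempty: "\<Gamma> \<noteq> {}"
  using A1 by (auto simp: face_def)

lemmas arc = compact nonempty

lemma det_nz: "det2 v1 v2 \<noteq> 0"
  using det_pos by simp

lemma A1_simps: "A1 \<in> \<Gamma>" "v1 \<bullet> A1 = supp \<Gamma> v1" "v2 \<bullet> A1 \<le> supp \<Gamma> v2"
  using A1 supp_upper[OF arc] by (auto simp: face_def)

lemma A2_simps: "A2 \<in> \<Gamma>" "v2 \<bullet> A2 = supp \<Gamma> v2" "v1 \<bullet> A2 \<le> supp \<Gamma> v1"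
  using A2 supp_upper[OF arc] by (auto simp: face_def)

definition triangle :: "(real^2) set" where
  "triangle = convex hull {A12, A1, A2}"

lemma triangle_le: "z \<in> triangle \<Longrightarrow> v1 \<bullet> z \<le> supp \<Gamma> v1 \<and> v2 \<bullet> z \<le> supp \<Gamma> v2"
proof -
  have "triangle \<subseteq> {z. v1 \<bullet> z \<le> supp \<Gamma> v1} \<inter> {z. v2 \<bullet> z \<le> supp \<Gamma> v2}"
    unfolding triangle_def
    by (intro hull_minimal convex_Int convex_halfspace_le) (auto simp: apex A1_simps A2_simps)
  then show "z \<in> triangle \<Longrightarrow> v1 \<bullet> z \<le> supp \<Gamma> v1 \<and> v2 \<bullet> z \<le> supp \<Gamma> v2"
    by auto
qed

text \<open>In the coordinates \<open>X\<close> and \<open>Y\<close> that vanish on the two lines, an exceeding normal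
  gives \<open>\<alpha> * X + \<beta> * Y\<close> a value below those at \<open>A1 = (0, a)\<close> and \<open>A2 = (b, 0)\<close>, so the point lies on
  the apex side of the chord.\<close>

lemma corner_region_subset_triangle: "corner_region \<Gamma> v1 v2 \<subseteq> triangle"
proof
  fix z assume "z \<in> corner_region \<Gamma> v1 v2"
  then obtain \<alpha> \<beta> where z: "v1 \<bullet> z \<le> supp \<Gamma> v1" "v2 \<bullet> z \<le> supp \<Gamma> v2"
    and \<alpha>\<beta>: "0 \<le> \<alpha>" "0 \<le> \<beta>"
    and exc: "supp \<Gamma> (\<alpha> *\<^sub>R v1 + \<beta> *\<^sub>R v2) < \<alpha> * (v1 \<bullet> z) + \<beta> * (v2 \<bullet> z)"
    by (auto simp: corner_region_def exceeds_def inner_add_left)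
  define X where "X = supp \<Gamma> v1 - v1 \<bullet> z"
  define Y where "Y = supp \<Gamma> v2 - v2 \<bullet> z"
  define a where "a = supp \<Gamma> v2 - v2 \<bullet> A1"
  define b where "b = supp \<Gamma> v1 - v1 \<bullet> A2"
  define e where "e = \<alpha> * X + \<beta> * Y"
  have nonneg: "0 \<le> X" "0 \<le> Y"
    using z by (auto simp: X_def Y_def)
  have "\<alpha> * (v1 \<bullet> A1) + \<beta> * (v2 \<bullet> A1) < \<alpha> * (v1 \<bullet> z) + \<beta> * (v2 \<bullet> z)"
    using exc supp_upper[OF arc A1_simps(1), of "\<alpha> *\<^sub>R v1 + \<beta> *\<^sub>R v2"] by (simp add: inner_add_left)
  then have ea: "e < \<beta> * a"
    by (simp add: e_def X_def Y_def a_def A1_simps algebra_simps)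
  have "\<alpha> * (v1 \<bullet> A2) + \<beta> * (v2 \<bullet> A2) < \<alpha> * (v1 \<bullet> z) + \<beta> * (v2 \<bullet> z)"
    using exc supp_upper[OF arc A2_simps(1), of "\<alpha> *\<^sub>R v1 + \<beta> *\<^sub>R v2"] by (simp add: inner_add_left)
  then have eb: "e < \<alpha> * b"
    by (simp add: e_def X_def Y_def b_def A2_simps algebra_simps)
  have "0 \<le> e"
    using nonneg \<alpha>\<beta> by (simp add: e_def)
  have pos: "0 < a" "0 < b" "0 < \<alpha>" "0 < \<beta>"
    using ea eb \<open>0 \<le> e\<close> \<alpha>\<beta> by (smt (verit) mult_nonneg_nonpos mult_eq_0_iff)+
  have "X / b + Y / a \<le> 1"
  proof (cases "e = 0")
    case True
    with nonneg \<alpha>\<beta> pos have "X = 0" "Y = 0"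
      by (auto simp: e_def add_nonneg_eq_0_iff)
    then show ?thesis by simp
  next
    case False
    with \<open>0 \<le> e\<close> have "e > 0" by simp
    have "(\<alpha> * X) / (\<alpha> * b) \<le> (\<alpha> * X) / e" "(\<beta> * Y) / (\<beta> * a) \<le> (\<beta> * Y) / e"
      using nonneg pos ea eb \<open>e > 0\<close> by (intro divide_left_mono; simp)+
    then have "X / b + Y / a \<le> (\<alpha> * X) / e + (\<beta> * Y) / e"
      using pos by simp
    also have "\<dots> = 1"
      using \<open>e > 0\<close> by (simp add: add_divide_distrib[symmetric] e_def)
    finally show ?thesis .
  qed
  moreover have "z = (1 - X / b - Y / a) *\<^sub>R A12 + (Y / a) *\<^sub>R A1 + (X / b) *\<^sub>R A2"
  proof (rule real2_eqI[OF det_nz])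
    have "X / b * (v1 \<bullet> A2) = X / b * supp \<Gamma> v1 - X"
      using pos by (simp add: b_def field_simps)
    then show "v1 \<bullet> z = v1 \<bullet> ((1 - X / b - Y / a) *\<^sub>R A12 + (Y / a) *\<^sub>R A1 + (X / b) *\<^sub>R A2)"
      by (simp add: inner_add_right apex A1_simps left_diff_distrib) (simp add: X_def)
    have "Y / a * (v2 \<bullet> A1) = Y / a * supp \<Gamma> v2 - Y"
      using pos by (simp add: a_def field_simps)
    then show "v2 \<bullet> z = v2 \<bullet> ((1 - X / b - Y / a) *\<^sub>R A12 + (Y / a) *\<^sub>R A1 + (X / b) *\<^sub>R A2)"
      by (simp add: inner_add_right apex A2_simps left_diff_distrib) (simp add: Y_def)
  qed
  ultimately show "z \<in> triangle"
    unfolding triangle_def convex_hull_3 using nonneg pos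
    by (intro CollectI exI[of _ "1 - X / b - Y / a"] exI[of _ "Y / a"] exI[of _ "X / b"]) simp
qed

lemma compact_triangle: "compact triangle"
  unfolding triangle_def by (intro compact_convex_hull) simp

lemma bounded_corner_region: "bounded (corner_region \<Gamma> v1 v2)"
  using corner_region_subset_triangle compact_imp_bounded[OF compact_triangle] bounded_subset by blast

text \<open>A normal that separates \<open>z\<close> from the hull would have a negative coefficient. Such a functional
  is at the apex at most what it is at \<open>A1\<close> or \<open>A2\<close>, so it cannot exceed its supremum over the
  curve anywhere on the triangle.\<close>

lemma triangle_in_hull:
  assumes z: "z \<in> triangle"
    and *: "\<And>\<alpha> \<beta>. 0 \<le> \<alpha> \<Longrightarrow> 0 \<le> \<beta> \<Longrightarrow> \<not> exceeds \<Gamma> z (\<alpha> *\<^sub>R v1 + \<beta> *\<^sub>R v2)"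
  shows "z \<in> convex hull \<Gamma>"
proof (rule ccontr)
  assume "z \<notin> convex hull \<Gamma>"
  moreover have "closed (convex hull \<Gamma>)"
    using compact by (intro compact_imp_closed compact_convex_hull)
  ultimately obtain a k where ak: "a \<bullet> z < k" "\<forall>x\<in>convex hull \<Gamma>. a \<bullet> x > k"
    using separating_hyperplane_closed_point[of "convex hull \<Gamma>" z] by auto
  define u where "u = - a"
  have sep: "supp \<Gamma> u < u \<bullet> z"
  proof -
    obtain y where y: "y \<in> \<Gamma>" "u \<bullet> y = supp \<Gamma> u"
      by (rule supp_attained[OF arc])
    with ak hull_inc[of y \<Gamma> convex] show ?thesis
      by (auto simp: u_def)
  qed
  obtain \<alpha> \<beta> where u: "u = \<alpha> *\<^sub>R v1 + \<beta> *\<^sub>R v2"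
    using det2_decompose[OF det_nz] .
  have "u \<bullet> A12 \<le> supp \<Gamma> u"
  proof (cases "\<alpha> < 0")
    case True
    have "\<alpha> * (supp \<Gamma> v1 - v1 \<bullet> A2) \<le> 0"
      using True A2_simps by (intro mult_nonpos_nonneg) auto
    then have "u \<bullet> A12 \<le> u \<bullet> A2"
      by (simp add: u inner_add_left apex A2_simps algebra_simps)
    then show ?thesis
      using supp_upper[OF arc A2_simps(1), of u] by linarith
  next
    case False
    have "\<beta> < 0"
    proof (rule ccontr)
      assume "\<not> \<beta> < 0"
      with False *[of \<alpha> \<beta>] sep show False
        by (simp add: exceeds_def u)
    qed
    then have "\<beta> * (supp \<Gamma> v2 - v2 \<bullet> A1) \<le> 0"
      using A1_simps by (intro mult_nonpos_nonneg) auto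
    then have "u \<bullet> A12 \<le> u \<bullet> A1"
      by (simp add: u inner_add_left apex A1_simps algebra_simps)
    then show ?thesis
      using supp_upper[OF arc A1_simps(1), of u] by linarith
  qed
  then have "triangle \<subseteq> {x. u \<bullet> x \<le> supp \<Gamma> u}"
    unfolding triangle_def using supp_upper[OF arc] A1_simps(1) A2_simps(1)
    by (intro hull_minimal convex_halfspace_le) auto
  with z sep show False
    by auto
qed

text \<open>By \<open>triangle_in_hull\<close> and \<open>in_hull_face\<close> the point lies in the hull of a face, and the faces in
  question are convex already.\<close>

lemma triangle_boundary_in_arc:
  assumes z: "z \<in> triangle"
    and *: "\<And>\<alpha> \<beta>. 0 \<le> \<alpha> \<Longrightarrow> 0 \<le> \<beta> \<Longrightarrow> \<not> exceeds \<Gamma> z (\<alpha> *\<^sub>R v1 + \<beta> *\<^sub>R v2)"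
    and \<alpha>\<beta>: "0 \<le> \<alpha>" "0 \<le> \<beta>" "\<alpha> + \<beta> > 0"
    and le: "supp \<Gamma> (\<alpha> *\<^sub>R v1 + \<beta> *\<^sub>R v2) \<le> (\<alpha> *\<^sub>R v1 + \<beta> *\<^sub>R v2) \<bullet> z"
  shows "z \<in> \<Gamma>"
proof -
  let ?w = "\<alpha> *\<^sub>R v1 + \<beta> *\<^sub>R v2"
  have "z \<in> convex hull \<Gamma>"
    using triangle_in_hull[OF z *] .
  moreover have "?w \<bullet> z = supp \<Gamma> ?w"
    using le *[OF \<alpha>\<beta>(1,2)] unfolding exceeds_def by linarith
  ultimately have "z \<in> convex hull (face \<Gamma> ?w)"
    by (rule in_hull_face[OF arc])
  also have "convex hull (face \<Gamma> ?w) = face \<Gamma> ?w"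
    using convex_face[OF \<alpha>\<beta>] by (simp add: hull_same)
  finally show ?thesis
    by (simp add: face_def)
qed

definition contour :: "(real^2) set" where
  "contour = closed_segment A2 A12 \<union> closed_segment A12 A1 \<union> \<Gamma>"

text \<open>The corner region without its sides on the two lines, written as an intersection of
  evidently open sets.\<close>

definition open_region :: "(real^2) set" where
  "open_region = {z. v1 \<bullet> z < supp \<Gamma> v1} \<inter> {z. v2 \<bullet> z < supp \<Gamma> v2} \<inter>
     (\<Union>(\<alpha>, \<beta>)\<in>{0..} \<times> {0..}. {z. supp \<Gamma> (\<alpha> *\<^sub>R v1 + \<beta> *\<^sub>R v2) < (\<alpha> *\<^sub>R v1 + \<beta> *\<^sub>R v2) \<bullet> z})"

lemma open_region_iff:
  "z \<in> open_region \<longleftrightarrow> v1 \<bullet> z < supp \<Gamma> v1 \<and> v2 \<bullet> z < supp \<Gamma> v2 \<and>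
     (\<exists>\<alpha> \<beta>. 0 \<le> \<alpha> \<and> 0 \<le> \<beta> \<and> exceeds \<Gamma> z (\<alpha> *\<^sub>R v1 + \<beta> *\<^sub>R v2))"
  by (auto simp: open_region_def exceeds_def)

lemma open_open_region: "open open_region"
  unfolding open_region_def
  by (intro open_Int open_UN ballI) (auto simp: open_halfspace_lt open_halfspace_gt)

lemma open_region_subset: "open_region \<subseteq> corner_region \<Gamma> v1 v2"
  by (auto simp: open_region_iff corner_region_def exceeds_def)

lemma segment_A12_A1: "z \<in> closed_segment A12 A1 \<Longrightarrow> v1 \<bullet> z = supp \<Gamma> v1 \<and> v2 \<bullet> z \<le> supp \<Gamma> v2"
proof -
  have "closed_segment A12 A1 \<subseteq> {z. v1 \<bullet> z = supp \<Gamma> v1} \<inter> {z. v2 \<bullet> z \<le> supp \<Gamma> v2}"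
    unfolding segment_convex_hull
    by (intro hull_minimal convex_Int convex_halfspace_le convex_hyperplane)
      (auto simp: apex A1_simps)
  then show "z \<in> closed_segment A12 A1 \<Longrightarrow> v1 \<bullet> z = supp \<Gamma> v1 \<and> v2 \<bullet> z \<le> supp \<Gamma> v2"
    by auto
qed

lemma segment_A2_A12: "z \<in> closed_segment A2 A12 \<Longrightarrow> v2 \<bullet> z = supp \<Gamma> v2 \<and> v1 \<bullet> z \<le> supp \<Gamma> v1"
proof -
  have "closed_segment A2 A12 \<subseteq> {z. v2 \<bullet> z = supp \<Gamma> v2} \<inter> {z. v1 \<bullet> z \<le> supp \<Gamma> v1}"
    unfolding segment_convex_hull
    by (intro hull_minimal convex_Int convex_halfspace_le convex_hyperplane)
      (auto simp: apex A2_simps)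
  then show "z \<in> closed_segment A2 A12 \<Longrightarrow> v2 \<bullet> z = supp \<Gamma> v2 \<and> v1 \<bullet> z \<le> supp \<Gamma> v1"
    by auto
qed

lemma contour_le: "z \<in> contour \<Longrightarrow> v1 \<bullet> z \<le> supp \<Gamma> v1 \<and> v2 \<bullet> z \<le> supp \<Gamma> v2"
  unfolding contour_def
  using segment_A12_A1 segment_A2_A12 supp_upper[OF arc] by fastforce

lemma open_region_disjoint_contour: "open_region \<inter> contour = {}"
proof -
  have "z \<notin> contour" if "z \<in> open_region" for z
  proof -
    have "z \<notin> closed_segment A2 A12" "z \<notin> closed_segment A12 A1"
      using that segment_A12_A1[of z] segment_A2_A12[of z] by (auto simp: open_region_iff)
    moreover have "z \<notin> \<Gamma>"
      using that supp_upper[OF arc, of z] by (auto simp: open_region_iff exceeds_def not_less[symmetric])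
    ultimately show ?thesis
      by (simp add: contour_def)
  qed
  then show ?thesis by auto
qed

text \<open>Normalised to \<open>\<alpha> + \<beta> = 1\<close>, the normals range over a compact segment. The points that reach one of
  their supporting lines hence form a projection of a closed set along a compact one, which is closed.\<close>

lemma closure_open_region_touches:
  assumes "z \<in> closure open_region"
  shows "\<exists>\<alpha> \<beta>. 0 \<le> \<alpha> \<and> 0 \<le> \<beta> \<and> \<alpha> + \<beta> > 0 \<and>
    supp \<Gamma> (\<alpha> *\<^sub>R v1 + \<beta> *\<^sub>R v2) \<le> (\<alpha> *\<^sub>R v1 + \<beta> *\<^sub>R v2) \<bullet> z"
proof -
  define w where "w t = (1 - t) *\<^sub>R v1 + t *\<^sub>R v2" for t :: real
  define E where "E = {y. \<exists>t. t \<in> {0..1} \<and> (t, y) \<in> {p. supp \<Gamma> (w (fst p)) \<le> w (fst p) \<bullet> snd p}}"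
  have cw: "continuous_on UNIV (\<lambda>p :: real \<times> (real^2). w (fst p))"
    unfolding w_def by (intro continuous_intros)
  have "closed {p :: real \<times> (real^2). supp \<Gamma> (w (fst p)) \<le> w (fst p) \<bullet> snd p}"
  proof (rule closed_Collect_le)
    show "continuous_on UNIV (\<lambda>p :: real \<times> (real^2). supp \<Gamma> (w (fst p)))"
      by (rule continuous_on_compose2[OF continuous_on_supp[OF arc, of UNIV] cw]) simp
    show "continuous_on UNIV (\<lambda>p :: real \<times> (real^2). w (fst p) \<bullet> snd p)"
      by (intro continuous_on_inner cw continuous_intros)
  qed
  then have "closed E"
    unfolding E_def by (intro closed_compact_projection) auto
  moreover have "open_region \<subseteq> E"
  proof
    fix y assume "y \<in> open_region"
    then obtain \<alpha> \<beta> where y: "0 \<le> \<alpha>" "0 \<le> \<beta>" "exceeds \<Gamma> y (\<alpha> *\<^sub>R v1 + \<beta> *\<^sub>R v2)"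
      by (auto simp: open_region_iff)
    have "\<alpha> + \<beta> > 0"
    proof (rule ccontr)
      assume "\<not> \<alpha> + \<beta> > 0"
      with y have "\<alpha> = 0" "\<beta> = 0" by auto
      with y supp_scale[OF arc, of 0 v1] show False
        by (simp add: exceeds_def)
    qed
    define t where "t = \<beta> / (\<alpha> + \<beta>)"
    have t1: "1 - t = \<alpha> / (\<alpha> + \<beta>)"
      using \<open>\<alpha> + \<beta> > 0\<close> by (simp add: t_def field_simps)
    have "\<alpha> *\<^sub>R v1 + \<beta> *\<^sub>R v2 = (\<alpha> + \<beta>) *\<^sub>R w t"
      using \<open>\<alpha> + \<beta> > 0\<close> by (simp add: w_def t1 scaleR_add_right) (simp add: t_def)
    with y \<open>\<alpha> + \<beta> > 0\<close> have "exceeds \<Gamma> y (w t)"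
      by (simp add: exceeds_scale[OF arc])
    moreover have "t \<in> {0..1}"
      using y \<open>\<alpha> + \<beta> > 0\<close> by (auto simp: t_def)
    ultimately show "y \<in> E"
      unfolding E_def exceeds_def by (auto intro: less_imp_le)
  qed
  ultimately have "z \<in> E"
    using assms closure_minimal by blast
  then obtain t where "t \<in> {0..1}" "supp \<Gamma> (w t) \<le> w t \<bullet> z"
    unfolding E_def by auto
  then show ?thesis
    unfolding w_def by (intro exI[of _ "1 - t"] exI[of _ t]) auto
qed

lemma frontier_open_region: "frontier open_region \<subseteq> contour"
proof
  fix z assume "z \<in> frontier open_region"
  then have z: "z \<in> closure open_region" "z \<notin> open_region"
    using open_open_region by (auto simp: frontier_def interior_open)
  have tri: "z \<in> triangle"
    using z(1) open_region_subset corner_region_subset_triangle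
      closure_minimal[OF _ compact_imp_closed[OF compact_triangle]] by blast
  show "z \<in> contour"
  proof (cases "\<exists>\<alpha> \<beta>. 0 \<le> \<alpha> \<and> 0 \<le> \<beta> \<and> exceeds \<Gamma> z (\<alpha> *\<^sub>R v1 + \<beta> *\<^sub>R v2)")
    case False
    then have "z \<in> \<Gamma>"
      using closure_open_region_touches[OF z(1)] triangle_boundary_in_arc[OF tri] by blast
    then show ?thesis by (simp add: contour_def)
  next
    case True
    then obtain \<alpha> \<beta> where \<alpha>\<beta>: "0 \<le> \<alpha>" "0 \<le> \<beta>"
      and exc: "supp \<Gamma> (\<alpha> *\<^sub>R v1 + \<beta> *\<^sub>R v2) < \<alpha> * (v1 \<bullet> z) + \<beta> * (v2 \<bullet> z)"
      by (auto simp: exceeds_def inner_add_left)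
    have le: "v1 \<bullet> z \<le> supp \<Gamma> v1" "v2 \<bullet> z \<le> supp \<Gamma> v2"
      using triangle_le[OF tri] by auto
    have a1: "\<alpha> * (v1 \<bullet> A1) + \<beta> * (v2 \<bullet> A1) < \<alpha> * (v1 \<bullet> z) + \<beta> * (v2 \<bullet> z)"
      using exc supp_upper[OF arc A1_simps(1), of "\<alpha> *\<^sub>R v1 + \<beta> *\<^sub>R v2"] by (simp add: inner_add_left)
    have a2: "\<alpha> * (v1 \<bullet> A2) + \<beta> * (v2 \<bullet> A2) < \<alpha> * (v1 \<bullet> z) + \<beta> * (v2 \<bullet> z)"
      using exc supp_upper[OF arc A2_simps(1), of "\<alpha> *\<^sub>R v1 + \<beta> *\<^sub>R v2"] by (simp add: inner_add_left)
    consider "v1 \<bullet> z = supp \<Gamma> v1" | "v2 \<bullet> z = supp \<Gamma> v2"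
      using True z(2) le by (fastforce simp: open_region_iff)
    then show ?thesis
    proof cases
      case 1
      with a1 have "\<beta> * (v2 \<bullet> A1) < \<beta> * (v2 \<bullet> z)"
        by (simp add: A1_simps)
      with \<alpha>\<beta> have "v2 \<bullet> A1 \<le> v2 \<bullet> z"
        by (simp add: mult_less_cancel_left)
      then have "z \<in> closed_segment A12 A1"
        using 1 le by (intro closed_segmentI2[OF det_nz]) (auto simp: apex A1_simps)
      then show ?thesis by (simp add: contour_def)
    next
      case 2
      with a2 have "\<alpha> * (v1 \<bullet> A2) < \<alpha> * (v1 \<bullet> z)"
        by (simp add: A2_simps)
      with \<alpha>\<beta> have "v1 \<bullet> A2 \<le> v1 \<bullet> z"
        by (simp add: mult_less_cancel_left)
      moreover have "det2 v2 v1 \<noteq> 0"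
        using det_nz by (simp add: det2_def algebra_simps)
      ultimately have "z \<in> closed_segment A12 A2"
        using 2 le by (intro closed_segmentI2[of v2 v1]) (auto simp: apex A2_simps)
      then show ?thesis by (simp add: contour_def closed_segment_commute)
    qed
  qed
qed

text \<open>A connected set that avoids the frontier of the open region cannot leave the region, and the region
  is bounded.\<close>

lemma open_region_subset_inside: "open_region \<subseteq> inside contour"
proof
  fix z assume z: "z \<in> open_region"
  then have "z \<notin> contour"
    using open_region_disjoint_contour by auto
  let ?C = "connected_component_set (- contour) z"
  have "?C \<subseteq> open_region"
  proof (rule ccontr)
    assume "\<not> ?C \<subseteq> open_region"
    then have "?C - open_region \<noteq> {}" by auto
    moreover have "z \<in> ?C"
      using \<open>z \<notin> contour\<close> by (simp add: connected_component_refl)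
    with z have "?C \<inter> open_region \<noteq> {}"
      by blast
    ultimately have "?C \<inter> frontier open_region \<noteq> {}"
      by (intro connected_Int_frontier connected_connected_component)
    with frontier_open_region connected_component_subset[of "- contour" z] show False
      by auto
  qed
  then have "bounded ?C"
    using open_region_subset bounded_corner_region bounded_subset by blast
  with \<open>z \<notin> contour\<close> show "z \<in> inside contour"
    by (simp add: inside_def)
qed

text \<open>Every point off the contour and outside the open region escapes to infinity along a ray:
  in the direction \<open>vi\<close> if it is on the far side of the line of \<open>vi\<close>, and otherwise in a direction
  that decreases \<open>v1\<close> and \<open>v2\<close>, hence every normal of the cone, so that it never reaches a face.\<close>

lemma inside_subset_open_region: "inside contour \<subseteq> open_region"
proof (rule subsetI, rule ccontr)
  fix z assume ins: "z \<in> inside contour" and z: "z \<notin> open_region"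
  have v_nz: "v1 \<noteq> 0" "v2 \<noteq> 0"
    using det2_nonzero[OF det_nz] by auto
  have z_notin: "z \<notin> contour"
    using ins by (simp add: inside_def)
  have ray: "z \<notin> inside contour"
    if "d \<noteq> 0" "\<And>t. 0 < t \<Longrightarrow> z + t *\<^sub>R d \<notin> contour" for d
    using that z_notin by (intro not_inside_if_ray[of d]) (metis add.right_neutral le_less scaleR_zero_left)+
  show False
  proof (cases "v1 \<bullet> z < supp \<Gamma> v1 \<and> v2 \<bullet> z < supp \<Gamma> v2")
    case False
    then consider "supp \<Gamma> v1 \<le> v1 \<bullet> z" | "supp \<Gamma> v2 \<le> v2 \<bullet> z"
      by linarith
    then show False
    proof cases
      case 1
      have "z + t *\<^sub>R v1 \<notin> contour" if "0 < t" for t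
      proof
        assume "z + t *\<^sub>R v1 \<in> contour"
        then have "v1 \<bullet> (z + t *\<^sub>R v1) \<le> supp \<Gamma> v1"
          using contour_le by blast
        moreover have "t * (v1 \<bullet> v1) > 0"
          using that v_nz by simp
        ultimately show False
          using 1 by (simp add: inner_add_right)
      qed
      with ray v_nz ins show False by blast
    next
      case 2
      have "z + t *\<^sub>R v2 \<notin> contour" if "0 < t" for t
      proof
        assume "z + t *\<^sub>R v2 \<in> contour"
        then have "v2 \<bullet> (z + t *\<^sub>R v2) \<le> supp \<Gamma> v2"
          using contour_le by blast
        moreover have "t * (v2 \<bullet> v2) > 0"
          using that v_nz by simp
        ultimately show False
          using 2 by (simp add: inner_add_right)
      qed
      with ray v_nz ins show False by blast
    qed
  next
    case True
    with z have no: "\<And>\<alpha> \<beta>. 0 \<le> \<alpha> \<Longrightarrow> 0 \<le> \<beta> \<Longrightarrow> \<not> exceeds \<Gamma> z (\<alpha> *\<^sub>R v1 + \<beta> *\<^sub>R v2)"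
      by (simp add: open_region_iff)
    \<comment> \<open>The direction pointing away from the apex into the corner.\<close>
    define d where "d = dual_point v1 v2 (-1) (-1)"
    have d: "v1 \<bullet> d = -1" "v2 \<bullet> d = -1"
      by (simp_all add: d_def inner_dual_point[OF det_nz])
    have "z + t *\<^sub>R d \<notin> contour" if "0 < t" for t
    proof
      assume "z + t *\<^sub>R d \<in> contour"
      moreover have "v1 \<bullet> (z + t *\<^sub>R d) < supp \<Gamma> v1" "v2 \<bullet> (z + t *\<^sub>R d) < supp \<Gamma> v2"
        using True that by (simp_all add: inner_add_right d)
      ultimately have "z + t *\<^sub>R d \<in> \<Gamma>"
        using segment_A12_A1 segment_A2_A12 unfolding contour_def by fastforce
      then obtain \<alpha> \<beta> where \<alpha>\<beta>: "0 \<le> \<alpha>" "0 \<le> \<beta>" "\<alpha> + \<beta> > 0"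
        and "z + t *\<^sub>R d \<in> face \<Gamma> (\<alpha> *\<^sub>R v1 + \<beta> *\<^sub>R v2)"
        using in_face by blast
      then have "(\<alpha> *\<^sub>R v1 + \<beta> *\<^sub>R v2) \<bullet> (z + t *\<^sub>R d) = supp \<Gamma> (\<alpha> *\<^sub>R v1 + \<beta> *\<^sub>R v2)"
        by (simp add: face_def)
      moreover have "(\<alpha> *\<^sub>R v1 + \<beta> *\<^sub>R v2) \<bullet> (z + t *\<^sub>R d)
          = (\<alpha> *\<^sub>R v1 + \<beta> *\<^sub>R v2) \<bullet> z - t * (\<alpha> + \<beta>)"
        by (simp add: inner_add_right inner_add_left d algebra_simps)
      moreover have "t * (\<alpha> + \<beta>) > 0"
        using \<alpha>\<beta> that by simp
      ultimately show False
        using no[OF \<alpha>\<beta>(1,2)] by (simp add: exceeds_def)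
    qed
    moreover have "d \<noteq> 0"
      using d by auto
    ultimately show False
      using ray ins by blast
  qed
qed

lemma inside_contour: "inside contour = open_region"
  using inside_subset_open_region open_region_subset_inside by blast

text \<open>The corner region and the inside of the contour differ only by points on the two lines.\<close>

theorem gap_square_sum_eq_area:
  "((\<lambda>w. (gap \<Gamma> (farey w (v1, v2)))\<^sup>2 / (2 * det2 v1 v2))
      has_sum measure lebesgue (inside contour)) UNIV"
proof -
  let ?R = "corner_region \<Gamma> v1 v2"
  have v_nz: "v1 \<noteq> 0" "v2 \<noteq> 0"
    using det2_nonzero[OF det_nz] by auto
  note area = gap_square_has_sum[OF arc det_pos bounded_corner_region]
  have "?R - open_region \<subseteq> {z. v1 \<bullet> z = supp \<Gamma> v1} \<union> {z. v2 \<bullet> z = supp \<Gamma> v2}"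
    by (auto simp: open_region_iff corner_region_def exceeds_def)
  moreover have "negligible ({z. v1 \<bullet> z = supp \<Gamma> v1} \<union> {z. v2 \<bullet> z = supp \<Gamma> v2})"
    using v_nz by (simp add: negligible_hyperplane)
  ultimately have "?R - open_region \<in> null_sets lebesgue"
    using negligible_subset negligible_iff_null_sets by blast
  then have "measure lebesgue (?R - (?R - open_region)) = measure lebesgue ?R"
    by (rule measure_Diff_null_set[OF area(2)])
  moreover have "?R - (?R - open_region) = open_region"
    using open_region_subset by auto
  ultimately show ?thesis
    using area(1) by (simp add: inside_contour)
qed

end

section \<open>Lattice lengths of the straight parts\<close>

lemma det2_zero_if_common_normal:
  assumes "d \<noteq> 0" "u \<bullet> d = 0" "v \<bullet> d = 0"
  shows "det2 u v = 0"
proof (rule ccontr)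
  assume "det2 u v \<noteq> 0"
  then have "d = 0"
    by (rule real2_eqI) (use assms in simp_all)
  with assms show False by simp
qed

lemma orthogonal_direction:
  fixes m d :: "real^2"
  assumes "m \<noteq> 0" "m \<bullet> d = 0"
  shows "\<exists>r. d = r *\<^sub>R vector [- (m$2), m$1]"
proof -
  let ?n = "vector [- (m$2), m$1] :: real^2"
  have sq: "det2 m ?n = (m$1)\<^sup>2 + (m$2)\<^sup>2" "?n \<bullet> ?n = (m$1)\<^sup>2 + (m$2)\<^sup>2" "m \<bullet> ?n = 0"
    by (simp_all add: det2_def inner_vec_def sum_2 power2_eq_square)
  have nz: "(m$1)\<^sup>2 + (m$2)\<^sup>2 \<noteq> 0"
    using assms(1) by (auto simp: vec_eq_iff forall_2 sum_power2_eq_zero_iff)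
  have "d = ((?n \<bullet> d) / (?n \<bullet> ?n)) *\<^sub>R ?n"
    using nz sq assms(2) by (intro real2_eqI[of m ?n]) simp_all
  then show ?thesis ..
qed

text \<open>A segment orthogonal to \<open>m\<close> is a multiple of \<open>m\<close> turned by a right angle. Its length in units of
  \<open>norm m\<close> is therefore seen by every \<open>u\<close> up to the factor \<open>det2 u m\<close>.\<close>

lemma abs_inner_orthogonal:
  fixes m d :: "real^2"
  assumes "m \<bullet> d = 0"
  shows "norm m * \<bar>u \<bullet> d\<bar> = \<bar>det2 u m\<bar> * norm d"
proof (rule power2_eq_imp_eq)
  have m: "m$1 * d$1 + m$2 * d$2 = 0"
    using assms by (simp add: inner_vec_def sum_2)
  have n: "(norm x)\<^sup>2 = (x$1)\<^sup>2 + (x$2)\<^sup>2" for x :: "real^2"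
    by (simp add: power2_norm_eq_inner) (simp add: inner_vec_def sum_2 power2_eq_square)
  have "((m$1)\<^sup>2 + (m$2)\<^sup>2) * (u$1 * d$1 + u$2 * d$2)\<^sup>2
      = (u$1 * m$2 - u$2 * m$1)\<^sup>2 * ((d$1)\<^sup>2 + (d$2)\<^sup>2)
        + (m$1 * d$1 + m$2 * d$2) *
          (2 * (u$1 * m$1 + u$2 * m$2) * (u$1 * d$1 + u$2 * d$2)
            - ((u$1)\<^sup>2 + (u$2)\<^sup>2) * (m$1 * d$1 + m$2 * d$2))"
    by (simp add: power2_eq_square algebra_simps)
  then show "(norm m * \<bar>u \<bullet> d\<bar>)\<^sup>2 = (\<bar>det2 u m\<bar> * norm d)\<^sup>2"
    using m by (simp add: power_mult_distrib n det2_def inner_vec_def sum_2)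
qed auto

lemma collinear_in_line:
  fixes w :: "real^2"
  assumes "w \<noteq> 0" "\<And>z. z \<in> X \<Longrightarrow> w \<bullet> z = k"
  shows "collinear X"
  unfolding collinear_def
proof (intro exI[of _ "vector [- (w$2), w$1]"] ballI)
  fix x y assume "x \<in> X" "y \<in> X"
  then show "\<exists>c. x - y = c *\<^sub>R vector [- (w$2), w$1]"
    using assms by (intro orthogonal_direction) (auto simp: inner_diff_right)
qed

lemma diameter_closed_segment_eq: "diameter (closed_segment A B) = dist A (B :: 'a::euclidean_space)"
proof (rule antisym)
  have "norm (x - y) \<le> norm (A - B)" if x: "x \<in> closed_segment A B" and y: "y \<in> closed_segment A B" for x y
  proof -
    have "norm (x - A) \<le> norm (A - B)" "norm (x - B) \<le> norm (A - B)"
      using segment_bound[OF x] by (simp_all add: norm_minus_commute)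
    with segment_furthest_le[OF y, of x] show ?thesis
      by linarith
  qed
  then show "diameter (closed_segment A B) \<le> dist A B"
    by (intro diameter_le) (auto simp: dist_norm)
  show "dist A B \<le> diameter (closed_segment A B)"
    by (intro diameter_bounded_bound compact_imp_bounded compact_segment) auto
qed

context
  fixes v1 v2 :: "real^2"
  assumes det_nz: "det2 v1 v2 \<noteq> 0"
begin

abbreviation (input) vec_of :: "int \<Rightarrow> int \<Rightarrow> real^2" where
  "vec_of a b \<equiv> of_int a *\<^sub>R v1 + of_int b *\<^sub>R v2"

lemma vec_of_eq_iff: "vec_of a b = vec_of a' b' \<longleftrightarrow> a = a' \<and> b = b'"
  using det2_independent[OF det_nz, of "of_int a" "of_int b" "of_int a'" "of_int b'"] by auto

lemma det2_vec_of: "det2 (vec_of a b) (vec_of a' b') = of_int (a * b' - b * a') * det2 v1 v2"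
  by (simp add: det2_simps) (simp add: det2_def algebra_simps)

lemma primitive_in_iff:
  "primitive_in (lattice_of v1 v2) v \<longleftrightarrow> (\<exists>a b. coprime a b \<and> v = vec_of a b)"
proof
  assume v: "primitive_in (lattice_of v1 v2) v"
  then obtain a b where ab: "v = vec_of a b"
    by (auto simp: primitive_in_def lattice_of_def)
  define g where "g = gcd a b"
  obtain a' b' where a': "a = a' * g" and b': "b = b' * g"
    unfolding g_def by (metis gcd_dvd1 gcd_dvd2 dvdE mult.commute)
  have "v \<noteq> 0"
    using v by (simp add: primitive_in_def)
  then have "g \<noteq> 0"
    using ab a' b' by auto
  moreover have "g \<ge> 0"
    by (simp add: g_def)
  moreover have "\<not> g \<ge> 2"
  proof
    assume "g \<ge> 2"
    have "v = real (nat g) *\<^sub>R vec_of a' b'"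
      using ab a' b' \<open>g \<ge> 0\<close> by (simp add: scaleR_add_right mult.commute)
    moreover have "vec_of a' b' \<in> lattice_of v1 v2"
      by (auto simp: lattice_of_def)
    moreover have "nat g \<ge> 2"
      using \<open>g \<ge> 2\<close> by simp
    ultimately show False
      using v unfolding primitive_in_def by blast
  qed
  ultimately have "g = 1" by simp
  then show "\<exists>a b. coprime a b \<and> v = vec_of a b"
    using ab unfolding g_def coprime_iff_gcd_eq_1 by (intro exI conjI)
next
  assume "\<exists>a b. coprime a b \<and> v = vec_of a b"
  then obtain a b where ab: "coprime a b" "v = vec_of a b" by auto
  have "v \<noteq> 0"
  proof
    assume "v = 0"
    then have "vec_of a b = vec_of 0 0"
      using ab by simp
    then have "a = 0" "b = 0"
      by (simp_all only: vec_of_eq_iff)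
    with ab show False by simp
  qed
  moreover have "v \<in> lattice_of v1 v2"
    using ab by (auto simp: lattice_of_def)
  moreover have "v \<noteq> real k *\<^sub>R w" if "w \<in> lattice_of v1 v2" "k \<ge> 2" for w k
  proof
    assume v: "v = real k *\<^sub>R w"
    obtain a' b' where "w = vec_of a' b'"
      using \<open>w \<in> _\<close> by (auto simp: lattice_of_def)
    with v ab have "vec_of a b = vec_of (int k * a') (int k * b')"
      by (simp add: scaleR_add_right)
    then have "a = int k * a'" "b = int k * b'"
      by (simp_all only: vec_of_eq_iff)
    with ab(1) have "int k dvd 1"
      by (metis coprime_common_divisor dvd_triv_left)
    with \<open>k \<ge> 2\<close> show False by simp
  qed
  ultimately show "primitive_in (lattice_of v1 v2) v"
    unfolding primitive_in_def by blast
qed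

text \<open>Parallel primitive vectors agree up to sign. This makes the lattice length independent of the
  normal vector chosen.\<close>

lemma parallel_primitive_norm:
  assumes "coprime a b" "coprime a' b'" "a * b' = b * a'"
  shows "norm (vec_of a b) = norm (vec_of a' b')"
proof -
  have "\<bar>a\<bar> * \<bar>b'\<bar> = \<bar>a'\<bar> * \<bar>b\<bar>"
    using assms(3) by (metis abs_mult mult.commute)
  moreover have "coprime a b" "coprime a' b'" by fact+
  ultimately have "\<bar>a\<bar> = \<bar>a'\<bar>" "\<bar>b\<bar> = \<bar>b'\<bar>"
    using coprime_crossproduct_int[of a b a' b'] by (auto simp: mult.commute)
  then consider "a' = a" "b' = b" | "a' = - a" "b' = - b"
    | "a' = a" "b' = - b" | "a' = - a" "b' = b"
    by linarith
  then show ?thesis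
  proof cases
    case 2
    then have "vec_of a' b' = - vec_of a b" by simp
    then show ?thesis by (metis norm_minus_cancel)
  next
    case 3
    with assms(3) have "a = 0 \<or> b = 0" by auto
    then show ?thesis using 3 by auto
  next
    case 4
    with assms(3) have "a = 0 \<or> b = 0" by auto
    then show ?thesis using 4 by auto
  qed auto
qed

lemma lattice_length_segment:
  assumes ab: "coprime a b" and AB: "vec_of a b \<bullet> A = vec_of a b \<bullet> B"
  shows "lattice_length (lattice_of v1 v2) (closed_segment A B) = dist A B / norm (vec_of a b)"
  unfolding lattice_length_def diameter_closed_segment_eq
proof (rule the_equality)
  have "closed_segment A B \<subseteq> {z. vec_of a b \<bullet> z = vec_of a b \<bullet> A}"
    unfolding segment_convex_hull
    by (intro hull_minimal convex_hyperplane) (simp add: AB)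
  then have "closed_segment A B \<subseteq> line (vec_of a b) (- (vec_of a b \<bullet> A))"
    by (auto simp: line_def)
  moreover have "primitive_in (lattice_of v1 v2) (vec_of a b)"
    using ab primitive_in_iff by blast
  ultimately show "\<exists>v k. primitive_in (lattice_of v1 v2) v \<and> closed_segment A B \<subseteq> line v k \<and>
      dist A B / norm (vec_of a b) = dist A B / norm v"
    by blast
next
  fix l assume "\<exists>v k. primitive_in (lattice_of v1 v2) v \<and> closed_segment A B \<subseteq> line v k \<and>
      l = dist A B / norm v"
  then obtain v k where v: "primitive_in (lattice_of v1 v2) v" "closed_segment A B \<subseteq> line v k"
    "l = dist A B / norm v"
    by blast
  show "l = dist A B / norm (vec_of a b)"
  proof (cases "A = B")
    case False
    obtain a' b' where ab': "coprime a' b'" "v = vec_of a' b'"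
      using v(1) primitive_in_iff by blast
    have "A \<in> line v k" "B \<in> line v k"
      using v(2) by auto
    then have "v \<bullet> (A - B) = 0"
      by (simp add: line_def inner_diff_right)
    moreover have "vec_of a b \<bullet> (A - B) = 0"
      using AB by (simp add: inner_diff_right)
    ultimately have "det2 (vec_of a b) (vec_of a' b') = 0"
      using False unfolding ab' by (intro det2_zero_if_common_normal[of "A - B"]) auto
    then have "a * b' - b * a' = 0"
      using det_nz by (simp only: det2_vec_of mult_eq_0_iff of_int_eq_0_iff simp_thms)
    then have "norm (vec_of a b) = norm (vec_of a' b')"
      using ab ab' by (intro parallel_primitive_norm) auto
    then show ?thesis
      using v(3) ab' by simp
  qed (use v in simp)
qed

end

text \<open>Completing the primitive normal \<open>m\<close> by a vector \<open>u\<close> of the lattice to a pair of the same determinant, the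
  lattice length becomes the variation of \<open>u\<close> along the segment.\<close>

lemma lattice_length_times_det:
  fixes v1 v2 :: "real^2"
  assumes "det2 v1 v2 \<noteq> 0" and m: "m = of_int a *\<^sub>R v1 + of_int b *\<^sub>R v2" "coprime a b" "m \<noteq> 0"
    and AB: "m \<bullet> A = m \<bullet> B" and u: "\<bar>det2 u m\<bar> = \<bar>det2 v1 v2\<bar>"
  shows "\<bar>det2 v1 v2\<bar> * lattice_length (lattice_of v1 v2) (closed_segment A B) = \<bar>u \<bullet> A - u \<bullet> B\<bar>"
proof -
  have "norm m * \<bar>u \<bullet> (A - B)\<bar> = \<bar>det2 u m\<bar> * norm (A - B)"
    using AB by (intro abs_inner_orthogonal) (simp add: inner_diff_right)
  moreover have "lattice_length (lattice_of v1 v2) (closed_segment A B) = dist A B / norm m"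
    using lattice_length_segment[OF assms(1) m(2), of A B] AB m(1) by simp
  moreover have "norm m > 0"
    using m(3) by simp
  ultimately have "norm m * (\<bar>det2 v1 v2\<bar> * lattice_length (lattice_of v1 v2) (closed_segment A B))
      = norm m * \<bar>u \<bullet> A - u \<bullet> B\<bar>"
    using u by (simp add: dist_norm inner_diff_right)
  with \<open>norm m > 0\<close> show ?thesis
    by simp
qed

lemma supp_closed_segment: "supp (closed_segment A B) u = max (u \<bullet> A) (u \<bullet> B)"
proof -
  have "closed_segment A B \<subseteq> {z. u \<bullet> z \<le> max (u \<bullet> A) (u \<bullet> B)}"
    unfolding segment_convex_hull by (intro hull_minimal convex_halfspace_le) auto
  then have le: "u \<bullet> z \<le> max (u \<bullet> A) (u \<bullet> B)" if "z \<in> closed_segment A B" for z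
    using that by auto
  show ?thesis
  proof (cases "u \<bullet> A \<le> u \<bullet> B")
    case True
    then have "supp (closed_segment A B) u = u \<bullet> B"
      using le by (intro supp_eqI) (auto simp: max_def)
    with True show ?thesis by simp
  next
    case False
    then have "supp (closed_segment A B) u = u \<bullet> A"
      using le by (intro supp_eqI) (auto simp: max_def)
    with False show ?thesis by simp
  qed
qed

context convex_arc
begin

definition normal :: "nat \<times> nat \<Rightarrow> real^2" where
  "normal p = real (fst p) *\<^sub>R v1 + real (snd p) *\<^sub>R v2"

definition edge :: "nat \<times> nat \<Rightarrow> (real^2) set" where
  "edge p = face \<Gamma> (normal p)"

text \<open>The primitive normals of the cone: the two boundary vectors and the mediants of the tree (\<open>directions_eq\<close>).\<close>

definition directions :: "(nat \<times> nat) set" where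
  "directions = {p. coprime (fst p) (snd p)}"

abbreviation len :: "(real^2) set \<Rightarrow> real" where
  "len \<equiv> lattice_length (lattice_of v1 v2)"

lemma mediant_eq_normal: "mediant (farey w (v1, v2)) = normal (node w)"
  by (simp add: mediant_farey normal_def)

lemma directions_eq: "directions = insert (1, 0) (insert (0, 1) (range node))"
proof (intro subset_antisym subsetI)
  fix p assume p: "p \<in> directions"
  then have cop: "coprime (fst p) (snd p)"
    by (simp add: directions_def)
  consider "fst p = 0" | "snd p = 0" | "0 < fst p" "0 < snd p"
    by auto
  then show "p \<in> insert (1, 0) (insert (0, 1) (range node))"
  proof cases
    case 1
    with cop have "p = (0, 1)" by (simp add: prod_eq_iff)
    then show ?thesis by simp
  next
    case 2
    with cop have "p = (1, 0)" by (simp add: prod_eq_iff)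
    then show ?thesis by simp
  next
    case 3
    then obtain w where "node w = p"
      using node_surj[OF cop] by auto
    then show ?thesis by auto
  qed
qed (auto simp: directions_def coprime_node)

lemma direction_pos: "p \<in> directions \<Longrightarrow> real (fst p) + real (snd p) > 0"
  by (cases p; cases "fst p"; cases "snd p") (auto simp: directions_def)

lemma normal_nz: "p \<in> directions \<Longrightarrow> normal p \<noteq> 0"
proof
  assume "p \<in> directions" "normal p = 0"
  then show False
    using det2_independent[OF det_nz, of "real (fst p)" "real (snd p)" 0 0]
    by (auto simp: normal_def directions_def)
qed

lemma edge_segment:
  assumes "p \<in> directions"
  obtains A B where "edge p = closed_segment A B" "normal p \<bullet> A = supp \<Gamma> (normal p)"
    "normal p \<bullet> B = supp \<Gamma> (normal p)"
proof -
  have "convex (edge p)"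
    unfolding edge_def normal_def using direction_pos[OF assms] by (intro convex_face) auto
  moreover have "collinear (edge p)"
    using normal_nz[OF assms] by (rule collinear_in_line) (auto simp: edge_def face_def)
  ultimately obtain A B where AB: "edge p = closed_segment A B"
    using compact_convex_collinear_segment[of "edge p"] compact_face[OF arc] face_nonempty[OF arc]
    by (auto simp: edge_def)
  then have "A \<in> edge p" "B \<in> edge p" by auto
  with AB show ?thesis
    by (intro that) (auto simp: edge_def face_def)
qed

lemma len_edge:
  assumes p: "p \<in> directions" and AB: "edge p = closed_segment A B"
    and u: "\<bar>det2 u (normal p)\<bar> = \<bar>det2 v1 v2\<bar>"
  shows "det2 v1 v2 * len (edge p) = \<bar>u \<bullet> A - u \<bullet> B\<bar>"
proof -
  have "A \<in> edge p" "B \<in> edge p"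
    using AB by auto
  then have "normal p \<bullet> A = normal p \<bullet> B"
    by (simp add: edge_def face_def)
  moreover have "normal p = of_int (int (fst p)) *\<^sub>R v1 + of_int (int (snd p)) *\<^sub>R v2"
    by (simp add: normal_def)
  moreover have "coprime (int (fst p)) (int (snd p))"
    using p by (simp add: directions_def)
  ultimately have "\<bar>det2 v1 v2\<bar> * len (closed_segment A B) = \<bar>u \<bullet> A - u \<bullet> B\<bar>"
    using normal_nz[OF p] u by (intro lattice_length_times_det[OF det_nz])
  then show ?thesis
    using AB det_pos by simp
qed

text \<open>The pair at \<open>w\<close> has the determinant of the initial pair, so its first member measures the face of
  its mediant.\<close>

lemma face_length_eq: "face_length \<Gamma> (farey w (v1, v2)) = det2 v1 v2 * len (edge (node w))"
proof -
  let ?u = "fst (farey w (v1, v2))" and ?v = "snd (farey w (v1, v2))"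
  have p: "node w \<in> directions"
    by (simp add: directions_eq)
  obtain A B where AB: "edge (node w) = closed_segment A B"
    "normal (node w) \<bullet> A = supp \<Gamma> (normal (node w))"
    "normal (node w) \<bullet> B = supp \<Gamma> (normal (node w))"
    using edge_segment[OF p] .
  have m: "normal (node w) = ?u + ?v"
    by (simp add: mediant_eq_normal[symmetric] mediant_def)
  have "det2 ?u (normal (node w)) = det2 v1 v2"
    by (simp add: m det2_simps det2_farey)
  then have "det2 v1 v2 * len (edge (node w)) = \<bar>?u \<bullet> A - ?u \<bullet> B\<bar>"
    by (intro len_edge[OF p AB(1)]) simp
  moreover have "face_length \<Gamma> (farey w (v1, v2))
      = max (?u \<bullet> A) (?u \<bullet> B) + max (?v \<bullet> A) (?v \<bullet> B) - supp \<Gamma> (normal (node w))"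
    using AB(1) by (simp add: face_length_def mediant_eq_normal edge_def supp_closed_segment)
  moreover have "?u \<bullet> A + ?v \<bullet> A = supp \<Gamma> (normal (node w))"
    "?u \<bullet> B + ?v \<bullet> B = supp \<Gamma> (normal (node w))"
    using AB(2,3) by (simp_all add: m inner_add_left)
  ultimately show ?thesis
    by linarith
qed

text \<open>The segment consists of the leg of the corner and the face of \<open>v1\<close>, because \<open>A1\<close> is the endpoint
  of that face far from the apex.\<close>

lemma len_A1_A12: "det2 v1 v2 * len (closed_segment A1 A12) = leg \<Gamma> v1 v2 + det2 v1 v2 * len (edge (1, 0))"
proof -
  have p: "(1, 0) \<in> directions" "normal (1, 0) = v1"
    by (simp_all add: directions_def normal_def)
  have u: "\<bar>det2 v2 v1\<bar> = \<bar>det2 v1 v2\<bar>"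
    by (simp add: det2_def abs_minus_commute mult.commute)
  have "\<bar>det2 v1 v2\<bar> * len (closed_segment A1 A12) = \<bar>v2 \<bullet> A1 - v2 \<bullet> A12\<bar>"
    using normal_nz[OF p(1)] p(2) u
    by (intro lattice_length_times_det[OF det_nz, where a = 1 and b = 0 and m = v1])
      (auto simp: apex A1_simps)
  then have 1: "det2 v1 v2 * len (closed_segment A1 A12) = supp \<Gamma> v2 - v2 \<bullet> A1"
    using det_pos A1_simps apex by simp
  obtain A B where AB: "edge (1, 0) = closed_segment A B"
    using edge_segment[OF p(1)] by blast
  have 2: "det2 v1 v2 * len (edge (1, 0)) = \<bar>v2 \<bullet> A - v2 \<bullet> B\<bar>"
    using u p by (intro len_edge[OF p(1) AB]) simp
  have face: "face \<Gamma> v1 = closed_segment A B"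
    using AB p by (simp add: edge_def)
  have "v2 \<bullet> A1 \<le> v2 \<bullet> A" "v2 \<bullet> A1 \<le> v2 \<bullet> B"
    using first[of A] first[of B] face by auto
  moreover have "closed_segment A B \<subseteq> {z. v2 \<bullet> z \<ge> min (v2 \<bullet> A) (v2 \<bullet> B)}"
    unfolding segment_convex_hull by (intro hull_minimal convex_halfspace_ge) auto
  with A1 face have "min (v2 \<bullet> A) (v2 \<bullet> B) \<le> v2 \<bullet> A1"
    by auto
  ultimately show ?thesis
    using 1 2 face by (simp add: leg_def supp_closed_segment)
qed

lemma len_A2_A12: "det2 v1 v2 * len (closed_segment A2 A12) = leg \<Gamma> v2 v1 + det2 v1 v2 * len (edge (0, 1))"
proof -
  have p: "(0, 1) \<in> directions" "normal (0, 1) = v2"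
    by (simp_all add: directions_def normal_def)
  have "\<bar>det2 v1 v2\<bar> * len (closed_segment A2 A12) = \<bar>v1 \<bullet> A2 - v1 \<bullet> A12\<bar>"
    using normal_nz[OF p(1)] p(2)
    by (intro lattice_length_times_det[OF det_nz, where a = 0 and b = 1 and m = v2])
      (auto simp: apex A2_simps)
  then have 1: "det2 v1 v2 * len (closed_segment A2 A12) = supp \<Gamma> v1 - v1 \<bullet> A2"
    using det_pos A2_simps apex by simp
  obtain A B where AB: "edge (0, 1) = closed_segment A B"
    using edge_segment[OF p(1)] by blast
  have 2: "det2 v1 v2 * len (edge (0, 1)) = \<bar>v1 \<bullet> A - v1 \<bullet> B\<bar>"
    using p by (intro len_edge[OF p(1) AB]) simp
  have face: "face \<Gamma> v2 = closed_segment A B"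
    using AB p by (simp add: edge_def)
  have "v1 \<bullet> A2 \<le> v1 \<bullet> A" "v1 \<bullet> A2 \<le> v1 \<bullet> B"
    using last[of A] last[of B] face by auto
  moreover have "closed_segment A B \<subseteq> {z. v1 \<bullet> z \<ge> min (v1 \<bullet> A) (v1 \<bullet> B)}"
    unfolding segment_convex_hull by (intro hull_minimal convex_halfspace_ge) auto
  with A2 face have "min (v1 \<bullet> A) (v1 \<bullet> B) \<le> v1 \<bullet> A2"
    by auto
  ultimately show ?thesis
    using 1 2 face by (simp add: leg_def supp_closed_segment)
qed

definition proper_directions :: "(nat \<times> nat) set" where
  "proper_directions = {p \<in> directions. \<not> (\<exists>A. edge p = {A})}"

lemma edge_proper_segment:
  assumes "p \<in> proper_directions"
  obtains A B where "edge p = closed_segment A B" "A \<noteq> B"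
proof -
  have p: "p \<in> directions" "\<not> (\<exists>A. edge p = {A})"
    using assms by (simp_all add: proper_directions_def)
  obtain A B where AB: "edge p = closed_segment A B"
    using edge_segment[OF p(1)] .
  with p(2) have "A \<noteq> B"
    by auto
  with AB show ?thesis
    by (rule that)
qed

lemma edge_subset: "edge p \<subseteq> \<Gamma>"
  by (auto simp: edge_def face_def)

lemma edge_straight:
  assumes "p \<in> proper_directions"
  shows "edge p \<in> straight_parts \<Gamma>"
proof -
  obtain A B where "edge p = closed_segment A B" "A \<noteq> B"
    using edge_proper_segment[OF assms] .
  with edge_subset[of p] show ?thesis
    unfolding straight_parts_def by auto
qed

lemma inj_on_edge: "inj_on edge proper_directions"
proof (rule inj_onI)
  fix p q assume p: "p \<in> proper_directions" and q: "q \<in> proper_directions" and eq: "edge p = edge q"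
  obtain A B where AB: "edge p = closed_segment A B" "A \<noteq> B"
    using edge_proper_segment[OF p] .
  have "A \<in> edge p" "B \<in> edge p" "A \<in> edge q" "B \<in> edge q"
    using AB(1) eq by auto
  then have "normal p \<bullet> (A - B) = 0" "normal q \<bullet> (A - B) = 0"
    by (auto simp: edge_def face_def inner_diff_right)
  then have "det2 (normal p) (normal q) = 0"
    using AB(2) by (intro det2_zero_if_common_normal[of "A - B"]) auto
  moreover have "det2 (normal p) (normal q)
      = (real (fst p) * real (snd q) - real (snd p) * real (fst q)) * det2 v1 v2"
    by (simp add: normal_def det2_simps) (simp add: det2_def algebra_simps)
  ultimately have "real (fst p * snd q) = real (fst q * snd p)"
    using det_nz by (simp add: mult.commute)
  then have "fst p * snd q = fst q * snd p"
    by (simp only: of_nat_eq_iff)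
  moreover have "coprime (fst p) (snd p)" "coprime (fst q) (snd q)"
    using p q by (auto simp: proper_directions_def directions_def)
  ultimately show "p = q"
    using coprime_crossproduct_nat[of "fst p" "snd p" "fst q" "snd q"]
    by (auto simp: prod_eq_iff mult.commute)
qed

text \<open>The midpoint of a straight part lies on some face. The linear functional attains its maximum there
  in the interior of the segment, so it is constant on it, and its normal is
  parallel to the given lattice vector.\<close>

lemma straight_part_in_edge:
  assumes I: "I \<in> straight_parts \<Gamma>" and v: "v \<in> lattice_of v1 v2" "v \<noteq> 0" "I \<subseteq> line v k"
  obtains p where "p \<in> proper_directions" "I \<subseteq> edge p"
proof -
  obtain A B where AB: "I = closed_segment A B" "A \<noteq> B" "closed_segment A B \<subseteq> \<Gamma>"
    using I by (auto simp: straight_parts_def)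
  then have in\<Gamma>: "A \<in> \<Gamma>" "B \<in> \<Gamma>" "midpoint A B \<in> \<Gamma>"
    by auto
  obtain \<alpha> \<beta> where \<alpha>\<beta>: "0 \<le> \<alpha>" "0 \<le> \<beta>" "\<alpha> + \<beta> > 0"
    and mid: "midpoint A B \<in> face \<Gamma> (\<alpha> *\<^sub>R v1 + \<beta> *\<^sub>R v2)"
    using in_face[OF in\<Gamma>(3)] by blast
  define w where "w = \<alpha> *\<^sub>R v1 + \<beta> *\<^sub>R v2"
  have "w \<bullet> midpoint A B = supp \<Gamma> w"
    using mid by (simp add: w_def face_def)
  then have "w \<bullet> A + w \<bullet> B = 2 * supp \<Gamma> w"
    by (simp add: midpoint_def inner_add_right)
  then have wAB: "w \<bullet> A = supp \<Gamma> w" "w \<bullet> B = supp \<Gamma> w"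
    using supp_upper[OF arc in\<Gamma>(1), of w] supp_upper[OF arc in\<Gamma>(2), of w] by linarith+
  obtain s t where v_eq: "v = of_int s *\<^sub>R v1 + of_int t *\<^sub>R v2"
    using v(1) by (auto simp: lattice_of_def)
  have "A \<in> line v k" "B \<in> line v k"
    using v(3) AB(1) by auto
  then have "v \<bullet> (A - B) = 0"
    by (simp add: line_def inner_diff_right)
  moreover have "w \<bullet> (A - B) = 0"
    using wAB by (simp add: inner_diff_right)
  ultimately have "det2 w v = 0"
    using AB(2) by (intro det2_zero_if_common_normal[of "A - B"]) auto
  moreover have "det2 w v = (\<alpha> * of_int t - \<beta> * of_int s) * det2 v1 v2"
    by (simp add: w_def v_eq det2_simps) (simp add: det2_def algebra_simps)
  ultimately have "\<alpha> * of_int t = \<beta> * of_int s"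
    using det_nz by simp
  then have cross: "\<alpha> * real (nat \<bar>t\<bar>) = \<beta> * real (nat \<bar>s\<bar>)"
    using \<alpha>\<beta> by (metis abs_mult abs_of_nonneg of_int_abs of_nat_nat abs_ge_zero)
  \<comment> \<open>Only the sign of the lattice vector is undetermined, and \<open>w\<close> has nonnegative coefficients; hence
    absolute values give the primitive vector with the direction of \<open>w\<close>.\<close>
  define g where "g = gcd (nat \<bar>s\<bar>) (nat \<bar>t\<bar>)"
  have "g \<noteq> 0"
  proof
    assume "g = 0"
    then have "nat \<bar>s\<bar> = 0 \<and> nat \<bar>t\<bar> = 0"
      by (simp only: g_def gcd_eq_0_iff)
    then have "s = 0" "t = 0"
      by simp_all
    with v(2) show False
      by (simp add: v_eq)
  qed
  then obtain a b where ab: "nat \<bar>s\<bar> = a * g" "nat \<bar>t\<bar> = b * g" "coprime a b"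
    using gcd_coprime_exists[of "nat \<bar>s\<bar>" "nat \<bar>t\<bar>"] unfolding g_def by metis
  have \<alpha>b: "\<alpha> * real b = \<beta> * real a"
    using cross \<open>g \<noteq> 0\<close> by (simp add: ab)
  have p: "(a, b) \<in> directions"
    using ab(3) by (simp add: directions_def)
  obtain r where r: "r > 0" "w = r *\<^sub>R normal (a, b)"
  proof (cases "a = 0")
    case True
    with p have "b = 1" by (simp add: directions_def)
    with True \<alpha>b have "\<alpha> = 0" by simp
    with \<alpha>\<beta> that[of \<beta>] show ?thesis
      by (simp add: w_def normal_def True \<open>b = 1\<close>)
  next
    case False
    have "\<beta> = (\<alpha> / real a) * real b"
      using \<alpha>b False by (simp add: field_simps)
    moreover have "\<alpha> > 0"
    proof (rule ccontr)
      assume "\<not> \<alpha> > 0"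
      with \<alpha>\<beta> have "\<alpha> = 0" by simp
      with \<alpha>b False \<alpha>\<beta> show False by simp
    qed
    ultimately show ?thesis
      using False that[of "\<alpha> / real a"] by (simp add: w_def normal_def scaleR_add_right)
  qed
  have "A \<in> edge (a, b)" "B \<in> edge (a, b)"
    using wAB in\<Gamma> face_scale[OF arc r(1), of "normal (a, b)"] unfolding edge_def r(2)[symmetric]
    by (auto simp: face_def)
  moreover have "convex (edge (a, b))"
    using edge_segment[OF p] convex_closed_segment by metis
  ultimately have "I \<subseteq> edge (a, b)"
    unfolding AB(1) by (intro closed_segment_subset)
  moreover have "(a, b) \<in> proper_directions"
    using p \<open>A \<in> edge (a, b)\<close> \<open>B \<in> edge (a, b)\<close> AB(2) by (auto simp: proper_directions_def)
  ultimately show ?thesis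
    using that by blast
qed

text \<open>A segment of the curve that contains two points of a supporting line lies on that line.\<close>

lemma edge_maximal:
  assumes p: "p \<in> proper_directions"
  shows "edge p \<in> maximal_straight_parts \<Gamma>"
proof -
  have "J = edge p" if J: "J \<in> straight_parts \<Gamma>" "edge p \<subseteq> J" for J
  proof -
    obtain A B where AB: "edge p = closed_segment A B" "A \<noteq> B"
      using edge_proper_segment[OF p] .
    obtain C D where CD: "J = closed_segment C D" "closed_segment C D \<subseteq> \<Gamma>"
      using J(1) by (auto simp: straight_parts_def)
    let ?h = "supp \<Gamma> (normal p)"
    have le: "normal p \<bullet> C \<le> ?h" "normal p \<bullet> D \<le> ?h"
      using CD(2) by (auto intro!: supp_upper[OF arc])
    have endpoint: "normal p \<bullet> C = ?h \<and> normal p \<bullet> D = ?h \<or> z = C \<or> z = D" if zF: "z \<in> edge p" for z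
    proof -
      obtain t where t: "0 \<le> t" "t \<le> 1" "z = (1 - t) *\<^sub>R C + t *\<^sub>R D"
        using subsetD[OF J(2) zF] unfolding CD(1) in_segment by auto
      have "normal p \<bullet> z = ?h"
        using zF by (simp add: edge_def face_def)
      then have "(1 - t) * (?h - normal p \<bullet> C) + t * (?h - normal p \<bullet> D) = 0"
        by (simp add: t(3) inner_add_right algebra_simps)
      then have "(1 - t) * (?h - normal p \<bullet> C) = 0" "t * (?h - normal p \<bullet> D) = 0"
        using t le by (simp_all add: add_nonneg_eq_0_iff)
      then show ?thesis
        using t(3) by auto
    qed
    have A: "A \<in> edge p" and B: "B \<in> edge p"
      using AB(1) by auto
    have "normal p \<bullet> A = ?h" "normal p \<bullet> B = ?h"
      using A B by (auto simp: edge_def face_def)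
    then have "normal p \<bullet> C = ?h" "normal p \<bullet> D = ?h"
      using endpoint[OF A] endpoint[OF B] AB(2) by auto
    then have "C \<in> edge p" "D \<in> edge p"
      using CD(2) by (auto simp: edge_def face_def)
    then have "J \<subseteq> edge p"
      unfolding CD(1) AB(1) by (intro closed_segment_subset) auto
    with J(2) show ?thesis by blast
  qed
  with edge_straight[OF p] show ?thesis
    by (auto simp: maximal_straight_parts_def)
qed

lemma lattice_straight_parts_eq:
  "{I \<in> maximal_straight_parts \<Gamma>. \<exists>v\<in>lattice_of v1 v2. v \<noteq> 0 \<and> (\<exists>k. I \<subseteq> line v k)}
     = edge ` proper_directions"
proof (intro subset_antisym subsetI)
  fix I assume "I \<in> {I \<in> maximal_straight_parts \<Gamma>.
    \<exists>v\<in>lattice_of v1 v2. v \<noteq> 0 \<and> (\<exists>k. I \<subseteq> line v k)}"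
  then obtain v k where I: "I \<in> maximal_straight_parts \<Gamma>"
    and v: "v \<in> lattice_of v1 v2" "v \<noteq> 0" "I \<subseteq> line v k"
    by auto
  from I have "I \<in> straight_parts \<Gamma>"
    by (simp add: maximal_straight_parts_def)
  then obtain p where p: "p \<in> proper_directions" "I \<subseteq> edge p"
    using straight_part_in_edge v by metis
  with I edge_straight[OF p(1)] have "edge p = I"
    by (auto simp: maximal_straight_parts_def)
  with p show "I \<in> edge ` proper_directions" by auto
next
  fix I assume "I \<in> edge ` proper_directions"
  then obtain p where p: "p \<in> proper_directions" "I = edge p" by auto
  have "normal p = of_int (int (fst p)) *\<^sub>R v1 + of_int (int (snd p)) *\<^sub>R v2"
    by (simp add: normal_def)
  then have "normal p \<in> lattice_of v1 v2"
    unfolding lattice_of_def by blast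
  moreover have "normal p \<noteq> 0"
    using p by (intro normal_nz) (simp add: proper_directions_def)
  moreover have "edge p \<subseteq> line (normal p) (- supp \<Gamma> (normal p))"
    by (auto simp: edge_def face_def line_def)
  ultimately show "I \<in> {I \<in> maximal_straight_parts \<Gamma>.
    \<exists>v\<in>lattice_of v1 v2. v \<noteq> 0 \<and> (\<exists>k. I \<subseteq> line v k)}"
    using p edge_maximal by blast
qed

lemma len_F_improper: "p \<in> directions \<Longrightarrow> p \<notin> proper_directions \<Longrightarrow> len (edge p) = 0"
proof -
  assume p: "p \<in> directions" "p \<notin> proper_directions"
  then obtain A where A: "edge p = closed_segment A A"
    by (auto simp: proper_directions_def)
  have "coprime (int (fst p)) (int (snd p))"
    using p by (simp add: directions_def)
  from lattice_length_segment[OF det_nz this, of A A] show "len (edge p) = 0"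
    by (simp add: A)
qed

theorem gap_sum_eq_length:
  "det2 v1 v2 * (len (closed_segment A1 A12) + len (closed_segment A2 A12)
      - lattice_length_curve (lattice_of v1 v2) \<Gamma>) = (\<Sum>\<^sub>\<infinity>w. gap \<Gamma> (farey w (v1, v2)))"
proof -
  let ?D = "det2 v1 v2"
  have "lattice_length_curve (lattice_of v1 v2) \<Gamma> = (\<Sum>\<^sub>\<infinity>I\<in>edge ` proper_directions. len I)"
    unfolding lattice_length_curve_def lattice_straight_parts_eq ..
  also have "\<dots> = (\<Sum>\<^sub>\<infinity>p\<in>proper_directions. len (edge p))"
    by (subst infsum_reindex[OF inj_on_edge]) (simp add: o_def)
  also have "\<dots> = (\<Sum>\<^sub>\<infinity>p\<in>directions. len (edge p))"
    by (intro infsum_cong_neutral) (auto simp: len_F_improper proper_directions_def)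
  finally have curve: "lattice_length_curve (lattice_of v1 v2) \<Gamma> = (\<Sum>\<^sub>\<infinity>p\<in>directions. len (edge p))" .
  have "(\<lambda>w. ?D * len (edge (node w))) summable_on UNIV"
    using gap_sum(1)[OF arc, of v1 v2] by (simp add: face_length_eq)
  then have sum: "(\<lambda>w. len (edge (node w))) summable_on UNIV"
    using det_nz by (simp add: summable_on_cmult_right')
  have "((\<lambda>w. len (edge (node w))) has_sum (\<Sum>\<^sub>\<infinity>w. len (edge (node w)))) UNIV"
    using sum by (rule has_sum_infsum)
  then have "((\<lambda>p. len (edge p)) has_sum (\<Sum>\<^sub>\<infinity>w. len (edge (node w)))) (range node)"
    using has_sum_reindex[OF inj_node, of "\<lambda>p. len (edge p)"] by (simp add: o_def)
  moreover have "(0, 1) \<notin> range node" "(1, 0) \<notin> insert (0, 1) (range node)"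
    using node_pos by (auto simp: prod_eq_iff image_iff)
  ultimately have "((\<lambda>p. len (edge p)) has_sum (len (edge (1, 0)) + (len (edge (0, 1))
      + (\<Sum>\<^sub>\<infinity>w. len (edge (node w)))))) directions"
    unfolding directions_eq by (intro has_sum_insert)
  then have "lattice_length_curve (lattice_of v1 v2) \<Gamma>
      = len (edge (1, 0)) + (len (edge (0, 1)) + (\<Sum>\<^sub>\<infinity>w. len (edge (node w))))"
    unfolding curve by (rule infsumI)
  moreover have "(\<Sum>\<^sub>\<infinity>w. face_length \<Gamma> (farey w (v1, v2))) = ?D * (\<Sum>\<^sub>\<infinity>w. len (edge (node w)))"
    unfolding face_length_eq by (rule infsum_cmult_right')
  ultimately show ?thesis
    using gap_sum(2)[OF arc, of v1 v2] len_A1_A12 len_A2_A12 by (simp add: algebra_simps)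
qed

end

section \<open>Graphs of concave functions\<close>

lemma concave_supergradient:
  fixes f :: "real \<Rightarrow> real"
  assumes "concave_on {a..b} f" "a < x" "x < b"
  shows "\<exists>m. \<forall>y\<in>{a..b}. f y \<le> f x + m * (y - x)"
proof -
  have "convex_on {a..b} (\<lambda>x. - f x)"
    using assms(1) by (simp add: concave_on_def)
  from convex_le_Inf_differential[OF this, of x] assms(2,3)
  obtain k where k: "\<And>y. y \<in> {a..b} \<Longrightarrow> - f y \<ge> - f x + k * (y - x)"
    by (auto simp: interior_atLeastAtMost_real)
  have "f y \<le> f x + (- k) * (y - x)" if "y \<in> {a..b}" for y
    using k[OF that] by simp
  then show ?thesis
    by blast
qed

lemma det2_coordinate: "det2 u v * z$1 = (u \<bullet> z) * v$2 - (v \<bullet> z) * u$2"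
  by (simp add: det2_def inner_vec_def sum_2 algebra_simps)

lemma compact_curve_graph:
  assumes "continuous_on {a..b} f"
  shows "compact (curve_graph a b f)"
proof -
  have eq: "(\<lambda>x. vector [x, f x] :: real^2) = (\<lambda>x. x *\<^sub>R vector [1, 0] + f x *\<^sub>R vector [0, 1])"
    by (simp add: fun_eq_iff vec_eq_iff forall_2)
  show ?thesis
    unfolding curve_graph_def eq
    by (intro compact_continuous_image continuous_intros assms compact_Icc)
qed

text \<open>One of \<open>v1\<close> and \<open>v2\<close> may have a negative or vanishing second coordinate: a supporting
  line at an endpoint may be vertical or pass below the graph. The lemma
  \<open>downward_face_singleton\<close> describes the faces of such normals.\<close>

locale concave_graph =
  fixes x0 x1 :: real and f :: "real \<Rightarrow> real" and v1 v2 A12 :: "real^2"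
  assumes x01: "x0 < x1"
    and concave: "concave_on {x0..x1} f"
    and cont: "continuous_on {x0..x1} f"
    and det_pos: "det2 v1 v2 > 0"
    and max1: "vector [x1, f x1] \<in> face (curve_graph x0 x1 f) v1"
    and max2: "vector [x0, f x0] \<in> face (curve_graph x0 x1 f) v2"
    and apex: "v1 \<bullet> A12 = supp (curve_graph x0 x1 f) v1" "v2 \<bullet> A12 = supp (curve_graph x0 x1 f) v2"
begin

abbreviation "\<Gamma> \<equiv> curve_graph x0 x1 f"

definition pt :: "real \<Rightarrow> real^2" where
  "pt x = vector [x, f x]"

lemma pt_nth [simp]: "pt x $ 1 = x" "pt x $ 2 = f x"
  by (simp_all add: pt_def)

lemma inner_pt: "w \<bullet> pt x = w$1 * x + w$2 * f x"
  by (simp add: inner_vec_def sum_2)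

lemma graph_eq: "\<Gamma> = pt ` {x0..x1}"
  by (simp add: curve_graph_def pt_def)

lemma compact_graph: "compact \<Gamma>"
  using cont by (rule compact_curve_graph)

lemma graph_nonempty: "\<Gamma> \<noteq> {}"
  using x01 by (simp add: graph_eq)

lemmas graph = compact_graph graph_nonempty

lemma in_face_iff: "z \<in> face \<Gamma> w \<longleftrightarrow> (\<exists>x\<in>{x0..x1}. z = pt x \<and> w \<bullet> pt x = supp \<Gamma> w)"
  by (auto simp: face_def graph_eq)

lemma pt_le: "x \<in> {x0..x1} \<Longrightarrow> w \<bullet> pt x \<le> supp \<Gamma> w"
  by (intro supp_upper[OF graph]) (simp add: graph_eq)

lemma max_eq: "v1 \<bullet> pt x1 = supp \<Gamma> v1" "v2 \<bullet> pt x0 = supp \<Gamma> v2"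
  using max1 max2 by (auto simp: face_def pt_def)

lemma concaveD:
  assumes "x \<in> {x0..x1}" "y \<in> {x0..x1}" "0 \<le> t" "t \<le> 1"
  shows "(1 - t) * f x + t * f y \<le> f ((1 - t) * x + t * y)"
  using concave_onD[OF concave, of t x y] assms by simp

text \<open>The orientation of the pair \<open>(v1, v2)\<close> against the chord, as expressed by the first coordinate of the
  difference of the endpoints in terms of \<open>v1\<close> and \<open>v2\<close>.\<close>

lemma chord:
  defines "s \<equiv> v1 \<bullet> (pt x1 - pt x0)" and "t \<equiv> v2 \<bullet> (pt x0 - pt x1)"
  shows "0 \<le> s" "0 \<le> t" "0 < s * v2$2 + t * v1$2"
proof -
  show "0 \<le> s" "0 \<le> t"
    using pt_le[of x0 v1] pt_le[of x1 v2] x01 by (auto simp: s_def t_def inner_diff_right max_eq)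
  have "det2 v1 v2 * (pt x1 - pt x0)$1 = s * v2$2 + t * v1$2"
    unfolding det2_coordinate s_def t_def by (simp add: inner_diff_right algebra_simps)
  moreover have "det2 v1 v2 * (pt x1 - pt x0)$1 > 0"
    using det_pos x01 by simp
  ultimately show "0 < s * v2$2 + t * v1$2"
    by simp
qed

lemma one_normal_upward: "0 < v1$2 \<or> 0 < v2$2"
  using chord by (smt (verit) mult_nonneg_nonpos)

text \<open>For a normal that does not point upward the functional is convex along the graph. If it had two maximisers
  it would be maximal at both endpoints, and then \<open>chord\<close> would force an upward
  normal.\<close>

lemma downward_face_singleton:
  assumes \<alpha>\<beta>: "0 \<le> \<alpha>" "0 \<le> \<beta>" "\<alpha> + \<beta> > 0" and w: "w = \<alpha> *\<^sub>R v1 + \<beta> *\<^sub>R v2" "w$2 \<le> 0"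
    and x: "x \<in> {x0..x1}" "w \<bullet> pt x = supp \<Gamma> w" and y: "y \<in> {x0..x1}" "w \<bullet> pt y = supp \<Gamma> w"
  shows "x = y"
proof (rule ccontr)
  assume "x \<noteq> y"
  have convex: "w \<bullet> pt ((1 - t) * p + t * q) \<le> (1 - t) * (w \<bullet> pt p) + t * (w \<bullet> pt q)"
    if "p \<in> {x0..x1}" "q \<in> {x0..x1}" "0 \<le> t" "t \<le> 1" for p q t
  proof -
    have "w$2 * f ((1 - t) * p + t * q) \<le> w$2 * ((1 - t) * f p + t * f q)"
      using concaveD[OF that] w(2) by (intro mult_left_mono_neg)
    then show ?thesis
      by (simp add: inner_pt algebra_simps)
  qed
  have ends: "w \<bullet> pt x0 = supp \<Gamma> w \<and> w \<bullet> pt x1 = supp \<Gamma> w"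
    if xy: "p < q" "p \<in> {x0..x1}" "w \<bullet> pt p = supp \<Gamma> w" "q \<in> {x0..x1}" "w \<bullet> pt q = supp \<Gamma> w" for p q
  proof
    define t where "t = (p - x0) / (q - x0)"
    have t: "0 \<le> t" "t < 1"
      using xy by (auto simp: t_def)
    have "t * (q - x0) = p - x0"
      using xy by (simp add: t_def)
    then have "(1 - t) * x0 + t * q = p"
      by (simp add: algebra_simps)
    then have "supp \<Gamma> w \<le> (1 - t) * (w \<bullet> pt x0) + t * supp \<Gamma> w"
      using convex[of x0 q t] t xy x01 by simp
    then have "(1 - t) * (supp \<Gamma> w - w \<bullet> pt x0) \<le> 0"
      by (simp add: algebra_simps)
    with t have "supp \<Gamma> w \<le> w \<bullet> pt x0"
      by (simp add: mult_le_0_iff)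
    then show "w \<bullet> pt x0 = supp \<Gamma> w"
      using pt_le[of x0 w] x01 by simp
    define r where "r = (q - p) / (x1 - p)"
    have r: "0 < r" "r \<le> 1"
      using xy by (auto simp: r_def)
    have "r * (x1 - p) = q - p"
      using xy by (simp add: r_def)
    then have "(1 - r) * p + r * x1 = q"
      by (simp add: algebra_simps)
    then have "supp \<Gamma> w \<le> (1 - r) * supp \<Gamma> w + r * (w \<bullet> pt x1)"
      using convex[of p x1 r] r xy x01 by simp
    then have "r * (supp \<Gamma> w - w \<bullet> pt x1) \<le> 0"
      by (simp add: algebra_simps)
    with r have "supp \<Gamma> w \<le> w \<bullet> pt x1"
      by (simp add: mult_le_0_iff)
    then show "w \<bullet> pt x1 = supp \<Gamma> w"
      using pt_le[of x1 w] x01 by simp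
  qed
  have "w \<bullet> pt x0 = supp \<Gamma> w \<and> w \<bullet> pt x1 = supp \<Gamma> w"
    using ends[of x y] ends[of y x] x y \<open>x \<noteq> y\<close> by linarith
  define s where "s = v1 \<bullet> (pt x1 - pt x0)"
  define t where "t = v2 \<bullet> (pt x0 - pt x1)"
  note st = chord[folded s_def t_def]
  have "w \<bullet> (pt x1 - pt x0) = 0"
    using \<open>w \<bullet> pt x0 = _ \<and> _\<close> by (simp add: inner_diff_right)
  then have rel: "\<alpha> * s = \<beta> * t"
    by (simp add: w(1) s_def t_def inner_add_left inner_diff_right algebra_simps)
  have w2: "w$2 = \<alpha> * v1$2 + \<beta> * v2$2"
    by (simp add: w(1))
  have "\<alpha> * (s * v2$2 + t * v1$2) = t * w$2"
    unfolding w2 using rel by (simp add: algebra_simps)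
  also have "\<dots> \<le> 0"
    using st w(2) by (simp add: mult_nonneg_nonpos)
  finally have "\<alpha> = 0"
    using st \<alpha>\<beta> by (simp add: mult_le_0_iff)
  have "\<beta> * (s * v2$2 + t * v1$2) = s * w$2"
    unfolding w2 using rel by (simp add: algebra_simps)
  also have "\<dots> \<le> 0"
    using st w(2) by (simp add: mult_nonneg_nonpos)
  finally have "\<beta> = 0"
    using st \<alpha>\<beta> by (simp add: mult_le_0_iff)
  with \<open>\<alpha> = 0\<close> \<alpha>\<beta> show False by simp
qed

lemma convex_face:
  assumes \<alpha>\<beta>: "0 \<le> \<alpha>" "0 \<le> \<beta>" "\<alpha> + \<beta> > 0"
  shows "convex (face \<Gamma> (\<alpha> *\<^sub>R v1 + \<beta> *\<^sub>R v2))"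
proof -
  define w where "w = \<alpha> *\<^sub>R v1 + \<beta> *\<^sub>R v2"
  have "convex (face \<Gamma> w)"
  proof (cases "w$2 \<le> 0")
    case True
    obtain z where z: "z \<in> face \<Gamma> w"
      using face_nonempty[OF graph, of w] by blast
    have "y = z" if "y \<in> face \<Gamma> w" for y
      using that z downward_face_singleton[OF \<alpha>\<beta> w_def True] unfolding in_face_iff by metis
    with z have "face \<Gamma> w = {z}"
      by blast
    then show ?thesis by simp
  next
    case False
    show ?thesis
      unfolding convex_alt
    proof (intro ballI allI impI)
      fix p q u assume "p \<in> face \<Gamma> w" "q \<in> face \<Gamma> w" and u: "0 \<le> u \<and> u \<le> (1::real)"
      then obtain x y where x: "x \<in> {x0..x1}" "p = pt x" "w \<bullet> pt x = supp \<Gamma> w"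
        and y: "y \<in> {x0..x1}" "q = pt y" "w \<bullet> pt y = supp \<Gamma> w"
        by (auto simp: in_face_iff)
      define z where "z = (1 - u) * x + u * y"
      have z: "z \<in> {x0..x1}"
        using convexD_alt[OF convex_real_interval(5), of x x0 x1 y u] x y u by (simp add: z_def)
      have le: "(1 - u) * f x + u * f y \<le> f z"
        using concaveD[of x y u] x y u by (simp add: z_def)
      have "supp \<Gamma> w = (1 - u) * (w \<bullet> pt x) + u * (w \<bullet> pt y)"
        by (simp add: x y algebra_simps)
      also have "\<dots> = w \<bullet> pt z - w$2 * (f z - ((1 - u) * f x + u * f y))"
        by (simp add: inner_pt z_def algebra_simps)
      finally have "w$2 * (f z - ((1 - u) * f x + u * f y)) \<le> 0"
        using pt_le[OF z, of w] by simp
      with False le have eq: "f z = (1 - u) * f x + u * f y"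
        by (simp add: mult_le_0_iff)
      then have pz: "(1 - u) *\<^sub>R p + u *\<^sub>R q = pt z"
        by (simp add: x y z_def vec_eq_iff forall_2)
      have "w \<bullet> pt z = (1 - u) * (w \<bullet> pt x) + u * (w \<bullet> pt y)"
        unfolding pz[symmetric] x(2) y(2) by (simp add: inner_add_right)
      then have "w \<bullet> pt z = supp \<Gamma> w"
        by (simp add: x y algebra_simps)
      then show "(1 - u) *\<^sub>R p + u *\<^sub>R q \<in> face \<Gamma> w"
        unfolding pz using z by (auto simp: in_face_iff)
    qed
  qed
  then show ?thesis by (simp add: w_def)
qed

text \<open>An interior point has an upward supporting normal \<open>w\<close>. If \<open>v1\<close> points upward, its maximality at the right
  endpoint bounds the slope of \<open>w\<close> and makes the coefficient at \<open>v2\<close> nonnegative; \<open>v2\<close> gives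
  the same for the other coefficient. If one of them points downward, its coefficient is nonnegative by
  the other's maximality, and then the other coefficient must be positive for \<open>w\<close> to point upward.\<close>

lemma in_some_face:
  assumes "z \<in> \<Gamma>"
  shows "\<exists>\<alpha> \<beta>. 0 \<le> \<alpha> \<and> 0 \<le> \<beta> \<and> \<alpha> + \<beta> > 0 \<and> z \<in> face \<Gamma> (\<alpha> *\<^sub>R v1 + \<beta> *\<^sub>R v2)"
proof -
  obtain x where x: "x \<in> {x0..x1}" "z = pt x"
    using assms by (auto simp: graph_eq)
  consider "x = x0" | "x = x1" | "x0 < x" "x < x1"
    using x by fastforce
  then show ?thesis
  proof cases
    case 1
    then have "z \<in> face \<Gamma> (0 *\<^sub>R v1 + 1 *\<^sub>R v2)"
      using max2 x by (simp add: pt_def)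
    then show ?thesis by (intro exI[of _ 0] exI[of _ 1]) simp
  next
    case 2
    then have "z \<in> face \<Gamma> (1 *\<^sub>R v1 + 0 *\<^sub>R v2)"
      using max1 x by (simp add: pt_def)
    then show ?thesis by (intro exI[of _ 1] exI[of _ 0]) simp
  next
    case 3
    obtain m where m: "\<And>y. y \<in> {x0..x1} \<Longrightarrow> f y \<le> f x + m * (y - x)"
      using concave_supergradient[OF concave 3] by blast
    define w :: "real^2" where "w = vector [- m, 1]"
    have w_nth: "w$1 = - m" "w$2 = 1"
      by (simp_all add: w_def)
    have "supp \<Gamma> w = w \<bullet> pt x"
    proof (rule supp_eqI)
      show "pt x \<in> \<Gamma>" using x by (simp add: graph_eq)
      show "w \<bullet> y \<le> w \<bullet> pt x" if "y \<in> \<Gamma>" for y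
        using that m by (fastforce simp: graph_eq inner_pt w_nth algebra_simps)
    qed
    then have face: "z \<in> face \<Gamma> w"
      using x by (auto simp: in_face_iff)
    obtain \<alpha> \<beta> where w: "w = \<alpha> *\<^sub>R v1 + \<beta> *\<^sub>R v2"
      using det2_decompose[of v1 v2] det_pos by auto
    have coeffs: "\<alpha> * det2 v1 v2 = - (v2$1 + m * v2$2)" "\<beta> * det2 v1 v2 = v1$1 + m * v1$2"
    proof -
      have "\<alpha> * det2 v1 v2 = det2 w v2" "\<beta> * det2 v1 v2 = det2 v1 w"
        by (simp_all add: w det2_simps)
      then show "\<alpha> * det2 v1 v2 = - (v2$1 + m * v2$2)" "\<beta> * det2 v1 v2 = v1$1 + m * v1$2"
        by (simp_all add: det2_def w_nth algebra_simps)
    qed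
    have height: "\<alpha> * v1$2 + \<beta> * v2$2 = 1"
      using w_nth(2) by (simp add: w)
    have \<beta>: "0 \<le> \<beta>" if "0 \<le> v1$2"
    proof -
      have "v1 \<bullet> pt x \<le> v1 \<bullet> pt x1"
        using pt_le[OF x(1)] max_eq by simp
      moreover have "v1$2 * f x1 \<le> v1$2 * (f x + m * (x1 - x))"
        using m[of x1] x01 that by (intro mult_left_mono) auto
      ultimately have "0 \<le> (v1$1 + m * v1$2) * (x1 - x)"
        by (simp add: inner_pt algebra_simps)
      with 3 have "0 \<le> v1$1 + m * v1$2"
        by (simp add: zero_le_mult_iff)
      with coeffs(2) det_pos show ?thesis
        by (metis zero_le_mult_iff not_less)
    qed
    have \<alpha>: "0 \<le> \<alpha>" if "0 \<le> v2$2"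
    proof -
      have "v2 \<bullet> pt x \<le> v2 \<bullet> pt x0"
        using pt_le[OF x(1)] max_eq by simp
      moreover have "v2$2 * f x0 \<le> v2$2 * (f x + m * (x0 - x))"
        using m[of x0] x01 that by (intro mult_left_mono) auto
      ultimately have "0 \<le> - (v2$1 + m * v2$2) * (x - x0)"
        by (simp add: inner_pt algebra_simps)
      with 3 have "0 \<le> - (v2$1 + m * v2$2)"
        by (simp add: zero_le_mult_iff mult_le_0_iff)
      with coeffs(1) det_pos show ?thesis
        by (metis zero_le_mult_iff not_less)
    qed
    have nonneg: "0 \<le> \<alpha> \<and> 0 \<le> \<beta>"
    proof (cases "0 \<le> v1$2 \<and> 0 \<le> v2$2")
      case True
      with \<alpha> \<beta> show ?thesis by simp
    next
      case False
      then consider "v1$2 < 0" "0 < v2$2" | "v2$2 < 0" "0 < v1$2"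
        using one_normal_upward by linarith
      then show ?thesis
      proof cases
        case 1
        then have "0 \<le> \<alpha>" using \<alpha> by simp
        moreover from this have "\<alpha> * v1$2 \<le> 0"
          using 1 by (simp add: mult_nonneg_nonpos)
        then have "0 < \<beta> * v2$2"
          using height by linarith
        ultimately show ?thesis
          using 1 by (simp add: zero_less_mult_iff)
      next
        case 2
        then have "0 \<le> \<beta>" using \<beta> by simp
        moreover from this have "\<beta> * v2$2 \<le> 0"
          using 2 by (simp add: mult_nonneg_nonpos)
        then have "0 < \<alpha> * v1$2"
          using height by linarith
        ultimately show ?thesis
          using 2 by (simp add: zero_less_mult_iff)
      qed
    qed
    moreover have "\<alpha> + \<beta> > 0"
    proof (rule ccontr)
      assume "\<not> \<alpha> + \<beta> > 0"
      with nonneg have "\<alpha> = 0" "\<beta> = 0" by auto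
      with height show False by simp
    qed
    ultimately show ?thesis
      using face w by auto
  qed
qed

text \<open>If \<open>v1\<close> points upward, a smaller value of \<open>v2\<close> on its supporting line means a larger first
  coordinate, and \<open>x1\<close> is the largest. Otherwise the face is a single point.\<close>

lemma first_endpoint:
  assumes "z \<in> face \<Gamma> v1"
  shows "v2 \<bullet> pt x1 \<le> v2 \<bullet> z"
proof -
  obtain x where x: "x \<in> {x0..x1}" "z = pt x" "v1 \<bullet> pt x = supp \<Gamma> v1"
    using assms by (auto simp: in_face_iff)
  show ?thesis
  proof (cases "v1$2 \<le> 0")
    case True
    have "x = x1"
      by (rule downward_face_singleton[of 1 0 v1]) (use True x x01 max_eq in simp_all)
    with x show ?thesis by simp
  next
    case False
    have "det2 v1 v2 * (pt x1 - pt x)$1 = (v2 \<bullet> pt x - v2 \<bullet> pt x1) * v1$2"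
      unfolding det2_coordinate by (simp add: inner_diff_right x(3) max_eq algebra_simps)
    moreover have "0 \<le> det2 v1 v2 * (pt x1 - pt x)$1"
      using det_pos x(1) by simp
    ultimately show ?thesis
      using False x(2) by (simp add: zero_le_mult_iff)
  qed
qed

lemma last_endpoint:
  assumes "z \<in> face \<Gamma> v2"
  shows "v1 \<bullet> pt x0 \<le> v1 \<bullet> z"
proof -
  obtain x where x: "x \<in> {x0..x1}" "z = pt x" "v2 \<bullet> pt x = supp \<Gamma> v2"
    using assms by (auto simp: in_face_iff)
  show ?thesis
  proof (cases "v2$2 \<le> 0")
    case True
    have "x = x0"
      by (rule downward_face_singleton[of 0 1 v2]) (use True x x01 max_eq in simp_all)
    with x show ?thesis by simp
  next
    case False
    have "det2 v1 v2 * (pt x - pt x0)$1 = (v1 \<bullet> pt x - v1 \<bullet> pt x0) * v2$2"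
      unfolding det2_coordinate by (simp add: inner_diff_right x(3) max_eq algebra_simps)
    moreover have "0 \<le> det2 v1 v2 * (pt x - pt x0)$1"
      using det_pos x(1) by simp
    ultimately show ?thesis
      using False x(2) by (simp add: zero_le_mult_iff)
  qed
qed

lemma convex_arc: "convex_arc \<Gamma> v1 v2 (vector [x1, f x1]) (vector [x0, f x0]) A12"
  using compact_graph det_pos max1 max2 apex convex_face in_some_face
    first_endpoint[unfolded pt_def] last_endpoint[unfolded pt_def]
  by unfold_locales auto

end

theorem theorem2:
  fixes x0 x1 P1 Q1 P2 Q2 D S L :: real
    and f :: "real \<Rightarrow> real"
    and c :: "real^2 \<Rightarrow> real"
    and A1 A2 A12 :: "real^2"
    and \<Gamma> \<Lambda> :: "(real^2) set"
  assumes "x0 < x1"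
    and "concave_on {x0..x1} f"
    and "continuous_on {x0..x1} f"
    and "\<And>x. x \<in> {x0..x1} \<Longrightarrow> 0 \<le> f x"
    and \<Gamma>: "\<Gamma> = curve_graph x0 x1 f"
    and A2: "A2 = vector [x0, f x0]"
    and A1: "A1 = vector [x1, f x1]"
    and c: "\<And>v. v \<noteq> 0 \<Longrightarrow> tangent \<Gamma> v (c v)"
    and D: "D = P1 * Q2 - P2 * Q1" "D > 0"
    and "tangent_at \<Gamma> (vector [P2, Q2]) (c (vector [P2, Q2])) A2"
    and "tangent_at \<Gamma> (vector [P1, Q1]) (c (vector [P1, Q1])) A1"
    and A12: "line (vector [P1, Q1]) (c (vector [P1, Q1])) \<inter>
              line (vector [P2, Q2]) (c (vector [P2, Q2])) = {A12}"
    and \<Lambda>: "\<Lambda> = lattice_of (vector [P1, Q1]) (vector [P2, Q2])"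
    and S: "S = measure lebesgue
                  (inside (closed_segment A2 A12 \<union> closed_segment A12 A1 \<union> \<Gamma>))"
    and L: "L = lattice_length \<Lambda> (closed_segment A1 A12)
              + lattice_length \<Lambda> (closed_segment A2 A12) - lattice_length_curve \<Lambda> \<Gamma>"
  shows "(\<lambda>M. (c (M $ 1) + c (M $ 2) - c (M $ 1 + M $ 2))\<^sup>2) summable_on
           SL2Z_plus_orbit (vector [vector [P1, Q1], vector [P2, Q2]]) \<and>
         1 / (2 * D) *
           (\<Sum>\<^sub>\<infinity>M \<in> SL2Z_plus_orbit (vector [vector [P1, Q1], vector [P2, Q2]]).
              (c (M $ 1) + c (M $ 2) - c (M $ 1 + M $ 2))\<^sup>2) = S \<and>
         (\<lambda>M. c (M $ 1 + M $ 2) - c (M $ 1) - c (M $ 2)) summable_on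
           SL2Z_plus_orbit (vector [vector [P1, Q1], vector [P2, Q2]]) \<and>
         1 / D *
           (\<Sum>\<^sub>\<infinity>M \<in> SL2Z_plus_orbit (vector [vector [P1, Q1], vector [P2, Q2]]).
              (c (M $ 1 + M $ 2) - c (M $ 1) - c (M $ 2))) = L"
proof -
  let ?v1 = "vector [P1, Q1] :: real^2" and ?v2 = "vector [P2, Q2] :: real^2"
  let ?O = "SL2Z_plus_orbit (vector [?v1, ?v2])"
  have det: "det2 ?v1 ?v2 = D"
    by (simp add: det2_def D(1) mult.commute)
  then have det_pos: "det2 ?v1 ?v2 > 0"
    using D(2) by simp
  have compact: "compact \<Gamma>"
    unfolding \<Gamma> using assms(3) by (rule compact_curve_graph)
  have nonempty: "\<Gamma> \<noteq> {}"
    using \<open>x0 < x1\<close> by (simp add: \<Gamma> curve_graph_def)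
  have c_eq: "c v = - supp \<Gamma> v" if "v \<noteq> 0" for v
    using c[OF that] tangent_iff_Sup[OF compact nonempty] by (simp add: supp_def)
  have touch: "A \<in> face \<Gamma> v" if "tangent_at \<Gamma> v (c v) A" for v A
    using that c_eq[of v] by (auto simp: tangent_at_def line_def face_def)
  have nz: "?v1 \<noteq> 0" "?v2 \<noteq> 0"
    using det2_nonzero[of ?v1 ?v2] det_pos by auto
  have apex: "?v1 \<bullet> A12 = supp \<Gamma> ?v1" "?v2 \<bullet> A12 = supp \<Gamma> ?v2"
  proof -
    have "A12 \<in> line ?v1 (c ?v1) \<inter> line ?v2 (c ?v2)"
      unfolding A12 by simp
    then show "?v1 \<bullet> A12 = supp \<Gamma> ?v1" "?v2 \<bullet> A12 = supp \<Gamma> ?v2"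
      by (auto simp: line_def c_eq nz)
  qed
  interpret graph: concave_graph x0 x1 f ?v1 ?v2 A12
    using assms(1-3) det_pos touch[OF assms(11)] touch[OF assms(12)] apex
    by unfold_locales (simp_all add: \<Gamma> A1 A2)
  interpret convex_arc \<Gamma> ?v1 ?v2 A1 A2 A12
    using graph.convex_arc by (simp add: \<Gamma> A1 A2)
  have orbit: "c (M $ 1) + c (M $ 2) - c (M $ 1 + M $ 2) = - gap \<Gamma> (rows M)" if "M \<in> ?O" for M
  proof -
    have "rows M \<in> range (\<lambda>w. farey w (?v1, ?v2))"
      using bij_betw_orbit[OF det_nz] that by (auto simp: bij_betw_def)
    then obtain w where "rows M = farey w (?v1, ?v2)"
      by auto
    then have "det2 (fst (rows M)) (snd (rows M)) \<noteq> 0"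
      using det_nz by (simp add: det2_farey)
    then have "M $ 1 \<noteq> 0" "M $ 2 \<noteq> 0" "M $ 1 + M $ 2 \<noteq> 0"
      using det2_nonzero by (auto simp: rows_def)
    then show ?thesis
      by (simp add: c_eq gap_def mediant_def rows_def)
  qed
  have "((\<lambda>M. (gap \<Gamma> (rows M))\<^sup>2 / (2 * D)) has_sum S) ?O"
    using gap_square_sum_eq_area has_sum_orbit_iff[OF det_nz, of "\<lambda>p. (gap \<Gamma> p)\<^sup>2 / (2 * D)" S]
    by (simp add: det S contour_def)
  from has_sum_cmult_right[OF this, of "2 * D"]
  have "((\<lambda>M. (gap \<Gamma> (rows M))\<^sup>2) has_sum 2 * D * S) ?O"
    using D(2) by simp
  then have area: "((\<lambda>M. (c (M $ 1) + c (M $ 2) - c (M $ 1 + M $ 2))\<^sup>2) has_sum 2 * D * S) ?O"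
    by (subst has_sum_cong[where g = "\<lambda>M. (gap \<Gamma> (rows M))\<^sup>2"]) (simp_all add: orbit)
  have "((\<lambda>w. gap \<Gamma> (farey w (?v1, ?v2))) has_sum D * L) UNIV"
    using has_sum_infsum[OF gap_summable[OF compact nonempty, of "(?v1, ?v2)"]]
    by (simp add: gap_sum_eq_length[symmetric] det L \<Lambda>)
  then have "((\<lambda>M. gap \<Gamma> (rows M)) has_sum D * L) ?O"
    using has_sum_orbit_iff[OF det_nz] by blast
  then have length: "((\<lambda>M. c (M $ 1 + M $ 2) - c (M $ 1) - c (M $ 2)) has_sum D * L) ?O"
    by (subst has_sum_cong[where g = "\<lambda>M. gap \<Gamma> (rows M)"]) (use orbit in \<open>simp_all add: algebra_simps\<close>)
  show ?thesis
    using area length D(2) by (auto simp: infsumI dest: has_sum_imp_summable)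
qed

end
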